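(* Let $k\ge 2$ and $d\ge 1$ be integers and let $0<\theta<1$ be a real number with $d\theta>1$. Let $N\ge 1$ and let $s_1\prec s_2\prec\cdots\prec s_N$ be elements of $\omega^{\not\downarrow\le k}$ with $|s_1|=\cdots=|s_N|<k$. Let $v\in\omega^{\not\downarrow k}$ with $s_N\prec v$, and suppose that $x\in\sum_{i=1}^N\oplus T[\mathcal A_d^k,s_i]\subset T(\mathcal A_d^k,\theta)$ satisfies $v<x$. If $x$ is decomposed as $x=x_1+\cdots+x_N$ with $x_i\in T[\mathcal A_d^k,s_i]$, then $$\max_{1\le i\le N}\|x_i\|\ \le\ \|x\|\ \le\ \frac{\theta(d-1)}{1-\theta}\,\max_{1\le i\le N}\|x_i\| .$$ In particular, if $\|x_1\|=\cdots=\|x_N\|=1$, then $\mathrm{span}\{x_1,\dots,x_N\}$ is isomorphic to $\ell_\infty^N$ in the canonical way (the unit vector basis of $\ell_\infty^N$ corresponding to $x_1,\dots,x_N$), with isomorphism constant independent of $N$ and of the $x_i$'s.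
   Context: Sequences and orders. $\omega=\{0,1,2,\dots\}$. For an integer $k\ge1$, $\omega^{\not\downarrow\le k}$ is the set of all non-decreasing finite sequences of elements of $\omega$ of length at most $k$ (including the empty sequence $()$), and $\omega^{\not\downarrow k}$ is the set of those of length exactly $k$; $|s|$ is the length of $s$. Write $s\sqsubset t$ if $s$ is a proper initial segment of $t$, and $s\sqsubseteq t$ if $s\sqsubset t$ or $s=t$. Let $<_{\mathrm{lex}}$ be the lexicographic order in which a proper initial segment precedes the longer sequence. The well-order $\prec$ (of order type $\omega$) on $\omega^{\not\downarrow\le k}$ is: $()\prec s$ for all nonempty $s$; and for nonempty sequences, $(s_1,\dots,s_i)\prec(t_1,\dots,t_j)$ iff $s_i<t_j$, or $s_i=t_j$ and $(s_1,\dots,s_i)<_{\mathrm{lex}}(t_1,\dots,t_j)$. The spaces $\mathcal E_k$. An $\mathcal E_k$-tree is a function $\widehat X:\omega^{\not\downarrow\le k}\to\omega^{\not\downarrow\le k}$ preserving $\prec$ and $\sqsubset$ (hence preserving lengths). $\mathcal E_k$ is the collection of all sets $X=\widehat X[\omega^{\not\downarrow k}]$, for $\widehat X$ an $\mathcal E_k$-tree. For $X\in\mathcal E_k$ and $n\ge1$, $r_n(X)$ is the set of the $\prec$-least $n$ elements of $X$; $\mathcal{AR}^k_n=\{r_n(X):X\in\mathcal E_k\}$, $\mathcal{AR}^k=\bigcup_{n\ge1}\mathcal{AR}^k_n$ and $\mathcal A_d^k=\bigcup_{i=1}^d\mathcal{AR}_i^k$. The Banach space $T(\mathcal A_d^k,\theta)$.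 For nonempty finite $E,F\subset\omega^{\not\downarrow k}$, $E<F$ (resp. $E\le F$) means $\max_\prec E\prec\min_\prec F$ (resp. $\preceq$); an element $v$ is treated as $\{v\}$. For $1\le m\le d$, a sequence $(E_i)_{i=1}^m$ in $\mathcal{AR}^k$ is $\mathcal A_d^k$-admissible if there is $\{v_1,\dots,v_m\}\in\mathcal A_d^k$ with $v_1\le E_1<v_2\le E_2<\cdots<v_m\le E_m$. On the space $c_{00}(\omega^{\not\downarrow k})$ of finitely supported functions $x:\omega^{\not\downarrow k}\to\mathbb R$, with canonical basis $(e_v)$ and $Ex=\sum_{v\in E}x_ve_v$, put $|x|_0=\max_v|x_v|$, $|x|_{j+1}=\max\{|x|_j,\ \theta\max\{\sum_{i=1}^m|E_ix|_j:1\le m\le d,\ (E_i)_{i=1}^m\ \mathcal A_d^k\text{-admissible}\}\}$, and $\|x\|=\sup_j|x|_j$. $T(\mathcal A_d^k,\theta)$ is the completion of $c_{00}(\omega^{\not\downarrow k})$ in this norm; $(e_v)$ is a 1-unconditional basis of it. For $x$ in this space, $v<x$ means $v\prec w$ for every $w$ in the support of $x$. Tree subspaces. For $s\in\omega^{\not\downarrow\le k}$, $\tau^k[s]=\{v\in\omega^{\not\downarrow k}:s\sqsubseteq v\}$ and $T[\mathcal A_d^k,s]$ is the closed linear span of $\{e_v:v\in\tau^k[s]\}$ in $T(\mathcal A_d^k,\theta)$. *)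

theory Defs
  imports "HOL-Analysis.Analysis" "HOL-Library.Sublist"
begin

section \<open>Non-decreasing sequences and the spaces \<open>\<E>\<^sub>k\<close>\<close>

definition seqs_le :: "nat \<Rightarrow> nat list set" where
  "seqs_le k = {s. sorted s \<and> length s \<le> k}"

definition seqs :: "nat \<Rightarrow> nat list set" where
  "seqs k = {s. sorted s \<and> length s = k}"

text \<open>
  The initial segment relations are \<open>prefix\<close> and \<open>strict_prefix\<close>; in \<open>ord_class.lexordp\<close> a proper initial
  segment precedes the longer sequence.
\<close>

definition prec :: "nat list \<Rightarrow> nat list \<Rightarrow> bool" (infix \<open>\<prec>\<^sub>\<omega>\<close> 50) where
  "s \<prec>\<^sub>\<omega> t \<longleftrightarrow>
     (s = [] \<and> t \<noteq> []) \<or>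
     (s \<noteq> [] \<and> t \<noteq> [] \<and> (last s < last t \<or> (last s = last t \<and> ord_class.lexordp s t)))"

definition preceq :: "nat list \<Rightarrow> nat list \<Rightarrow> bool" (infix \<open>\<preceq>\<^sub>\<omega>\<close> 50) where
  "s \<preceq>\<^sub>\<omega> t \<longleftrightarrow> s \<prec>\<^sub>\<omega> t \<or> s = t"

definition Ek_tree :: "nat \<Rightarrow> (nat list \<Rightarrow> nat list) \<Rightarrow> bool" where
  "Ek_tree k X \<longleftrightarrow>
     X \<in> seqs_le k \<rightarrow> seqs_le k \<and>
     (\<forall>s\<in>seqs_le k. \<forall>t\<in>seqs_le k. s \<prec>\<^sub>\<omega> t \<longrightarrow> X s \<prec>\<^sub>\<omega> X t) \<and>
     (\<forall>s\<in>seqs_le k. \<forall>t\<in>seqs_le k. strict_prefix s t \<longrightarrow> strict_prefix (X s) (X t))"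

definition Ek :: "nat \<Rightarrow> nat list set set" where
  "Ek k = {X ` seqs k |X. Ek_tree k X}"

text \<open>
  The \<open>n\<close> least elements of \<open>X\<close> are those with fewer than \<open>n\<close> predecessors in \<open>X\<close>. For \<open>X \<in> Ek k\<close>
  the cardinality is that of a finite set, because \<open>\<prec>\<^sub>\<omega>\<close> has order type \<open>\<omega>\<close> on \<open>seqs_le k\<close>.
\<close>

definition restr :: "nat \<Rightarrow> nat list set \<Rightarrow> nat list set" where
  "restr n X = {v \<in> X. card {u \<in> X. u \<prec>\<^sub>\<omega> v} < n}"

definition ARn :: "nat \<Rightarrow> nat \<Rightarrow> nat list set set" where
  "ARn k n = restr n ` Ek k"

definition AR :: "nat \<Rightarrow> nat list set set" where
  "AR k = (\<Union>n\<in>{1..}. ARn k n)"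

definition Ad :: "nat \<Rightarrow> nat \<Rightarrow> nat list set set" where
  "Ad k d = (\<Union>i\<in>{1..d}. ARn k i)"


section \<open>The space \<open>T(\<A>\<^sub>d\<^sup>k, \<theta>)\<close>\<close>

definition prec_max :: "nat list set \<Rightarrow> nat list" where
  "prec_max E = (THE m. m \<in> E \<and> (\<forall>v\<in>E. v \<preceq>\<^sub>\<omega> m))"

definition prec_min :: "nat list set \<Rightarrow> nat list" where
  "prec_min E = (THE m. m \<in> E \<and> (\<forall>v\<in>E. m \<preceq>\<^sub>\<omega> v))"

definition set_less :: "nat list set \<Rightarrow> nat list set \<Rightarrow> bool" where
  "set_less E F \<longleftrightarrow> prec_max E \<prec>\<^sub>\<omega> prec_min F"

definition set_leq :: "nat list set \<Rightarrow> nat list set \<Rightarrow> bool" where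
  "set_leq E F \<longleftrightarrow> prec_max E \<preceq>\<^sub>\<omega> prec_min F"

definition admissible :: "nat \<Rightarrow> nat \<Rightarrow> nat list set list \<Rightarrow> bool" where
  "admissible k d Es \<longleftrightarrow>
     1 \<le> length Es \<and> length Es \<le> d \<and> set Es \<subseteq> AR k \<and>
     (\<exists>vs. length vs = length Es \<and> set vs \<in> Ad k d \<and>
        (\<forall>i<length Es. set_leq {vs ! i} (Es ! i)) \<and>
        (\<forall>i. Suc i < length Es \<longrightarrow> set_less (Es ! i) {vs ! Suc i}))"

definition c00 :: "nat \<Rightarrow> (nat list \<Rightarrow> real) set" where
  "c00 k = {x. finite {v. x v \<noteq> 0} \<and> {v. x v \<noteq> 0} \<subseteq> seqs k}"

definition proj :: "nat list set \<Rightarrow> (nat list \<Rightarrow> real) \<Rightarrow> nat list \<Rightarrow> real" where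
  "proj E x = (\<lambda>v. if v \<in> E then x v else 0)"

text \<open>
  For \<open>x \<in> c00 k\<close> the two inner suprema below range over finite nonempty sets of reals (the summands
  depend only on the intersections of the \<open>E\<^sub>i\<close> with the support of \<open>x\<close>), so they are maxima.
\<close>

primrec T_norm_step :: "nat \<Rightarrow> nat \<Rightarrow> real \<Rightarrow> nat \<Rightarrow> (nat list \<Rightarrow> real) \<Rightarrow> real" where
  "T_norm_step k d \<theta> 0 = (\<lambda>x. SUP v\<in>seqs k. \<bar>x v\<bar>)"
| "T_norm_step k d \<theta> (Suc j) = (\<lambda>x.
     max (T_norm_step k d \<theta> j x)
         (\<theta> * (SUP Es\<in>{Es. admissible k d Es}. \<Sum>E\<leftarrow>Es. T_norm_step k d \<theta> j (proj E x))))"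

definition T_norm :: "nat \<Rightarrow> nat \<Rightarrow> real \<Rightarrow> (nat list \<Rightarrow> real) \<Rightarrow> real" where
  "T_norm k d \<theta> x = (SUP j. T_norm_step k d \<theta> j x)"

text \<open>
  A completion of \<open>(c00 k, T_norm k d \<theta>)\<close> is a complete set \<open>T\<close> in some normed space together with
  a linear isometry \<open>\<iota>\<close> of \<open>c00 k\<close> onto a dense subset of \<open>T\<close>; it is unique up to isometric
  isomorphism. Since \<open>T\<close> need not be the whole ambient type, a single ambient type such as
  the bounded real sequences accommodates every choice of \<open>k\<close>, \<open>d\<close> and \<open>\<theta>\<close>.
\<close>

definition T_completion ::
  "nat \<Rightarrow> nat \<Rightarrow> real \<Rightarrow> ((nat list \<Rightarrow> real) \<Rightarrow> 'b::real_normed_vector) \<Rightarrow> 'b set \<Rightarrow> bool" where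
  "T_completion k d \<theta> \<iota> T \<longleftrightarrow>
     (\<forall>x\<in>c00 k. \<forall>y\<in>c00 k. \<iota> (\<lambda>v. x v + y v) = \<iota> x + \<iota> y) \<and>
     (\<forall>c. \<forall>x\<in>c00 k. \<iota> (\<lambda>v. c * x v) = c *\<^sub>R \<iota> x) \<and>
     (\<forall>x\<in>c00 k. norm (\<iota> x) = T_norm k d \<theta> x) \<and>
     complete T \<and> closure (\<iota> ` c00 k) = T"

definition basis_vec :: "((nat list \<Rightarrow> real) \<Rightarrow> 'b) \<Rightarrow> nat list \<Rightarrow> 'b" where
  "basis_vec \<iota> v = \<iota> (indicator {v})"

text \<open>
  Coordinates with respect to the unconditional basis \<open>(e\<^sub>v)\<close>: the unique scalars \<open>a\<close> with
  \<open>x = (\<Sum>v. a v *\<^sub>R e\<^sub>v)\<close>.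
\<close>

definition coords ::
  "nat \<Rightarrow> ((nat list \<Rightarrow> real) \<Rightarrow> 'b::real_normed_vector) \<Rightarrow> 'b \<Rightarrow> nat list \<Rightarrow> real" where
  "coords k \<iota> x = (THE a. (\<forall>v. v \<notin> seqs k \<longrightarrow> a v = 0) \<and>
                          ((\<lambda>v. a v *\<^sub>R basis_vec \<iota> v) has_sum x) (seqs k))"

definition supp ::
  "nat \<Rightarrow> ((nat list \<Rightarrow> real) \<Rightarrow> 'b::real_normed_vector) \<Rightarrow> 'b \<Rightarrow> nat list set" where
  "supp k \<iota> x = {v. coords k \<iota> x v \<noteq> 0}"

definition before ::
  "nat \<Rightarrow> ((nat list \<Rightarrow> real) \<Rightarrow> 'b::real_normed_vector) \<Rightarrow> nat list \<Rightarrow> 'b \<Rightarrow> bool" where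
  "before k \<iota> v x \<longleftrightarrow> (\<forall>w\<in>supp k \<iota> x. v \<prec>\<^sub>\<omega> w)"


section \<open>Tree subspaces\<close>

definition tree_nodes :: "nat \<Rightarrow> nat list \<Rightarrow> nat list set" where
  "tree_nodes k s = {v \<in> seqs k. prefix s v}"

definition tree_subspace ::
  "nat \<Rightarrow> ((nat list \<Rightarrow> real) \<Rightarrow> 'b::real_normed_vector) \<Rightarrow> nat list \<Rightarrow> 'b set" where
  "tree_subspace k \<iota> s = closure (span (basis_vec \<iota> ` tree_nodes k s))"


section \<open>Canonical isomorphism with \<open>\<ell>\<^sub>\<infinity>\<^sup>N\<close>\<close>

text \<open>
  \<open>\<ell>\<^sub>\<infinity>\<^sup>N\<close> is carried by the functions vanishing off \<open>{1..N}\<close>, with unit vectors \<open>indicator {i}\<close>.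
  \<open>C\<close> bounds the product of the norms of the isomorphism and of its inverse.
\<close>

definition linf :: "nat \<Rightarrow> (nat \<Rightarrow> real) set" where
  "linf N = {a. \<forall>i. i \<notin> {1..N} \<longrightarrow> a i = 0}"

definition linf_norm :: "nat \<Rightarrow> (nat \<Rightarrow> real) \<Rightarrow> real" where
  "linf_norm N a = Max ((\<lambda>i. \<bar>a i\<bar>) ` {1..N})"

definition canonically_linf :: "nat \<Rightarrow> (nat \<Rightarrow> 'b::real_normed_vector) \<Rightarrow> real \<Rightarrow> bool" where
  "canonically_linf N y C \<longleftrightarrow> (\<exists>\<Phi>.
     (\<forall>a\<in>linf N. \<forall>b\<in>linf N. \<Phi> (\<lambda>i. a i + b i) = \<Phi> a + \<Phi> b) \<and>
     (\<forall>c. \<forall>a\<in>linf N. \<Phi> (\<lambda>i. c * a i) = c *\<^sub>R \<Phi> a) \<and>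
     (\<forall>i\<in>{1..N}. \<Phi> (indicator {i}) = y i) \<and>
     bij_betw \<Phi> (linf N) (span (y ` {1..N})) \<and>
     (\<exists>A B. 0 < A \<and> 0 < B \<and> A * B \<le> C \<and>
        (\<forall>a\<in>linf N. norm (\<Phi> a) \<le> A * linf_norm N a) \<and>
        (\<forall>a\<in>linf N. linf_norm N a \<le> B * norm (\<Phi> a))))"

end

theory Submission imports Defs begin

text \<open>
  The members of an admissible sequence follow one another, so at most one member that meets the
  support of \<open>x\<close> starts before \<open>v\<close>. Any member starting after \<open>v\<close> has its
  least element after all the \<open>s\<^sub>i\<close>, and the tree structure then forces it to meet at most
  one of the trees above them; it contributes at most \<open>M = max \<parallel>x\<^sub>i\<parallel>\<close>. By induction on the
  index \<open>j\<close> of the approximating norms, \<open>\<bar>x\<bar>\<^sub>j \<le> C M\<close>, where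
  \<open>C = \<theta> (d - 1) / (1 - \<theta>)\<close> is the fixed point of \<open>c \<mapsto> \<theta> (c + d - 1)\<close>. The lower bound is
  1-unconditionality. Since the coordinates in the completion are limits of the coordinates of
  approximants and only finitely many nodes precede \<open>v\<close>, approximants of the \<open>x\<^sub>i\<close> can be cut
  off at \<open>v\<close>, which reduces the theorem to finitely supported vectors.
\<close>

section \<open>The order on finite sequences\<close>

lemma prec_irrefl: "\<not> s \<prec>\<^sub>\<omega> s"
  by (auto simp: prec_def lexordp_irreflexive')

lemma prec_trans: "s \<prec>\<^sub>\<omega> t \<Longrightarrow> t \<prec>\<^sub>\<omega> u \<Longrightarrow> s \<prec>\<^sub>\<omega> u"
  unfolding prec_def by (auto dest: lexordp_trans)

lemma prec_total: "s \<prec>\<^sub>\<omega> t \<or> s = t \<or> t \<prec>\<^sub>\<omega> s"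
  unfolding prec_def using lexordp_linear[of s t] by (cases "last s" "last t" rule: linorder_cases) auto

text \<open>The relation is linear on all lists, sorted or not, so order reasoning below carries no
  membership side conditions.\<close>

interpretation prec: linorder preceq prec
proof
  fix s t u
  show "s \<prec>\<^sub>\<omega> t \<longleftrightarrow> s \<preceq>\<^sub>\<omega> t \<and> \<not> t \<preceq>\<^sub>\<omega> s"
    unfolding preceq_def using prec_irrefl prec_trans[of s t s] by metis
  show "s \<preceq>\<^sub>\<omega> s" by (simp add: preceq_def)
  show "s \<preceq>\<^sub>\<omega> t \<Longrightarrow> t \<preceq>\<^sub>\<omega> u \<Longrightarrow> s \<preceq>\<^sub>\<omega> u"
    unfolding preceq_def using prec_trans[of s t u] by metis
  show "s \<preceq>\<^sub>\<omega> t \<Longrightarrow> t \<preceq>\<^sub>\<omega> s \<Longrightarrow> s = t"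
    unfolding preceq_def using prec_irrefl prec_trans[of s t s] by metis
  show "s \<preceq>\<^sub>\<omega> t \<or> t \<preceq>\<^sub>\<omega> s"
    unfolding preceq_def using prec_total[of s t] by metis
qed

text \<open>The minimum is a definite description, so it carries information only once a least
  element is known to exist, by induction on the finite set, and to be unique, by
  antisymmetry.\<close>

lemma prec_min_props:
  assumes "finite E" "E \<noteq> {}"
  shows "prec_min E \<in> E" "v \<in> E \<Longrightarrow> prec_min E \<preceq>\<^sub>\<omega> v"
proof -
  have "\<exists>m\<in>E. \<forall>v\<in>E. m \<preceq>\<^sub>\<omega> v"
    using assms
  proof (induction E rule: finite_ne_induct)
    case (insert a F)
    then obtain m where "m \<in> F" "\<forall>v\<in>F. m \<preceq>\<^sub>\<omega> v" by blast
    then show ?case using prec.linear[of a m] prec.order_trans by blast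
  qed simp
  then obtain m where m: "m \<in> E \<and> (\<forall>v\<in>E. m \<preceq>\<^sub>\<omega> v)" by blast
  then have "prec_min E = m"
    unfolding prec_min_def using prec.order_antisym by (intro the_equality) blast+
  with m show "prec_min E \<in> E" "v \<in> E \<Longrightarrow> prec_min E \<preceq>\<^sub>\<omega> v" by auto
qed

lemma prec_max_props:
  assumes "finite E" "E \<noteq> {}"
  shows "prec_max E \<in> E" "v \<in> E \<Longrightarrow> v \<preceq>\<^sub>\<omega> prec_max E"
proof -
  have "\<exists>m\<in>E. \<forall>v\<in>E. v \<preceq>\<^sub>\<omega> m"
    using assms
  proof (induction E rule: finite_ne_induct)
    case (insert a F)
    then obtain m where "m \<in> F" "\<forall>v\<in>F. v \<preceq>\<^sub>\<omega> m" by blast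
    then show ?case using prec.linear[of a m] prec.order_trans by blast
  qed simp
  then obtain m where m: "m \<in> E \<and> (\<forall>v\<in>E. v \<preceq>\<^sub>\<omega> m)" by blast
  then have "prec_max E = m"
    unfolding prec_max_def using prec.order_antisym by (intro the_equality) blast+
  with m show "prec_max E \<in> E" "v \<in> E \<Longrightarrow> v \<preceq>\<^sub>\<omega> prec_max E" by auto
qed

lemma sorted_le_last:
  assumes "sorted u" "a \<in> set u"
  shows "a \<le> last u"
proof -
  obtain i where i: "i < length u" "u ! i = a" using assms(2) by (metis in_set_conv_nth)
  moreover have "u ! i \<le> u ! (length u - 1)" using i assms(1) by (intro sorted_nth_mono) auto
  moreover have "u \<noteq> []" using assms(2) by auto
  ultimately show ?thesis by (simp add: last_conv_nth)
qed

text \<open>A sorted sequence that is not all zeros has a positive last entry, and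
  \<open>prec\<close> compares last entries first. Hence the length \<open>n\<close> is free; the
  case of \<open>n\<close> larger than \<open>length u\<close> is what
  \<open>AR_meets_one_tree\<close> needs.\<close>

lemma replicate_zero_prec:
  assumes "sorted u" "u \<noteq> replicate (length u) (0::nat)"
  shows "replicate n 0 \<prec>\<^sub>\<omega> u"
proof -
  have "u \<noteq> []" using assms(2) by auto
  obtain a where a: "a \<in> set u" "a \<noteq> 0"
    using assms(2) replicate_eqI[of u "length u" 0] by auto
  then have "0 < last u" using sorted_le_last[OF assms(1)] by force
  then show ?thesis using \<open>u \<noteq> []\<close> by (cases "n = 0") (auto simp: prec_def)
qed

text \<open>A sorted sequence is bounded by its last entry, which \<open>preceq\<close> bounds by
  \<open>last v\<close>; there are finitely many lists of length \<open>k\<close> over a finite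
  alphabet.\<close>

lemma finite_prec_seqs: "finite {u \<in> seqs k. u \<preceq>\<^sub>\<omega> v}"
proof (rule finite_subset)
  show "finite {u. set u \<subseteq> {..last v} \<and> length u = k}"
    by (rule finite_lists_length_eq) simp
  have "a \<le> last v" if u: "sorted u" "u \<preceq>\<^sub>\<omega> v" and a: "a \<in> set u" for u a
  proof -
    have "last u \<le> last v" using u(2) a by (auto simp: preceq_def prec_def)
    with sorted_le_last[OF u(1) a] show ?thesis by simp
  qed
  then show "{u \<in> seqs k. u \<preceq>\<^sub>\<omega> v} \<subseteq> {u. set u \<subseteq> {..last v} \<and> length u = k}"
    by (auto simp: seqs_def)
qed

section \<open>Approximations and admissible sequences\<close>

lemma replicate_in_seqs: "replicate k 0 \<in> seqs k"
  by (simp add: seqs_def)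

lemma seqs_subset_seqs_le: "seqs k \<subseteq> seqs_le k"
  by (auto simp: seqs_def seqs_le_def)

text \<open>The initial segments of \<open>t\<close> form a chain whose images have strictly
  increasing lengths between \<open>0\<close> and \<open>k\<close>. Counting up from
  \<open>0\<close> and down from \<open>k\<close> squeezes the length at step \<open>i\<close> to
  exactly \<open>i\<close>.\<close>

lemma Ek_tree_length:
  assumes X: "Ek_tree k X" and t: "t \<in> seqs k" and i: "i \<le> k"
  shows "length (X (take i t)) = i"
proof -
  have in_le: "take j t \<in> seqs_le k" for j
    using t by (auto simp: seqs_def seqs_le_def sorted_wrt_take)
  have incr: "length (X (take j t)) < length (X (take (Suc j) t))" if "j < k" for j
  proof -
    have "take (Suc j) t = take j t @ [t ! j]"
      using t that by (simp add: seqs_def take_Suc_conv_app_nth)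
    then have "strict_prefix (take j t) (take (Suc j) t)" by (simp add: strict_prefix_def)
    then have "strict_prefix (X (take j t)) (X (take (Suc j) t))"
      using X in_le unfolding Ek_tree_def by blast
    then show ?thesis by (rule prefix_length_less)
  qed
  have lower: "j \<le> k \<Longrightarrow> j \<le> length (X (take j t))" for j
  proof (induction j)
    case (Suc j) then show ?case using incr[of j] by simp
  qed simp
  have upper: "j \<le> k \<Longrightarrow> length (X (take j t)) \<le> j" for j
  proof (induction rule: inc_induct)
    case base
    have "X (take k t) \<in> seqs_le k" using X in_le unfolding Ek_tree_def by blast
    then show ?case by (simp add: seqs_le_def)
  next
    case (step n) then show ?case using incr[of n] by simp
  qed
  show ?thesis using lower upper i by (simp add: le_antisym)
qed

lemma Ek_tree_take:
  assumes X: "Ek_tree k X" and t: "t \<in> seqs k" and i: "i \<le> k"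
  shows "take i (X t) = X (take i t)"
\<comment> \<open>For \<open>i = k\<close> the truncation is \<open>t\<close> itself, not a proper
  initial segment, so preservation of \<open>strict_prefix\<close> says nothing there.\<close>
proof (cases "i = k")
  case True
  then show ?thesis using Ek_tree_length[OF X t, of k] t by (simp add: seqs_def)
next
  case False
  then have "strict_prefix (take i t) t"
    using i t by (auto simp: seqs_def strict_prefix_def take_is_prefix)
  moreover have "take i t \<in> seqs_le k" "t \<in> seqs_le k"
    using t by (auto simp: seqs_def seqs_le_def sorted_wrt_take)
  ultimately have "prefix (X (take i t)) (X t)"
    using X by (simp add: Ek_tree_def strict_prefix_def)
  then show ?thesis
    using Ek_tree_length[OF X t i] by (auto simp: prefix_def)
qed

lemma Ek_tree_image_subset: "Ek_tree k X \<Longrightarrow> X ` seqs k \<subseteq> seqs k"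
proof
  fix w assume X: "Ek_tree k X" and "w \<in> X ` seqs k"
  then obtain t where t: "t \<in> seqs k" "w = X t" by auto
  then have "w \<in> seqs_le k" using X seqs_subset_seqs_le unfolding Ek_tree_def by blast
  moreover have "length w = k" using Ek_tree_length[OF X t(1), of k] t by (simp add: seqs_def)
  ultimately show "w \<in> seqs k" by (simp add: seqs_def seqs_le_def)
qed

lemma Ek_tree_replicate_least:
  assumes "Ek_tree k X" "t \<in> seqs k"
  shows "X (replicate k 0) \<preceq>\<^sub>\<omega> X t"
proof (cases "t = replicate k 0")
  case False
  then have "replicate k 0 \<prec>\<^sub>\<omega> t" using assms(2) by (intro replicate_zero_prec) (auto simp: seqs_def)
  then show ?thesis
    using assms replicate_in_seqs seqs_subset_seqs_le unfolding Ek_tree_def preceq_def by blast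
qed (simp add: preceq_def)

text \<open>Collects what later arguments use of an approximation: a tree \<open>X\<close>
  containing it, finiteness, and membership of the image of the zero branch, which is the least
  element of the whole image of \<open>X\<close>.\<close>

lemma AR_obtain_tree:
  assumes "E \<in> AR k"
  obtains X where "Ek_tree k X" "E \<subseteq> X ` seqs k" "X (replicate k 0) \<in> E"
    "finite E" "E \<subseteq> seqs k"
proof -
  obtain n X where n: "n \<ge> 1" and X: "Ek_tree k X" and E: "E = restr n (X ` seqs k)"
    using assms by (auto simp: AR_def ARn_def Ek_def)
  let ?Y = "X ` seqs k"
  have Y: "?Y \<subseteq> seqs k" by (rule Ek_tree_image_subset[OF X])
  \<comment> \<open>Ranks are cardinalities, and \<open>card\<close> is \<open>0\<close> on infinite
    sets, so finiteness of the sets of predecessors comes first.\<close>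
  have fin: "finite {u \<in> ?Y. u \<prec>\<^sub>\<omega> v}" for v
    by (rule finite_subset[OF _ finite_prec_seqs[of k v]]) (use Y in \<open>auto simp: preceq_def\<close>)
  have "{u \<in> ?Y. u \<prec>\<^sub>\<omega> X (replicate k 0)} = {}"
    using Ek_tree_replicate_least[OF X] prec.not_le by blast
  then have "X (replicate k 0) \<in> E"
    using n replicate_in_seqs by (simp only: E restr_def mem_Collect_eq card.empty) simp
  moreover have "finite E"
  \<comment> \<open>The rank strictly increases along the order, hence embeds \<open>E\<close> into
    the numbers below \<open>n\<close>.\<close>
  proof (rule inj_on_finite[where f = "\<lambda>v. card {u \<in> ?Y. u \<prec>\<^sub>\<omega> v}" and B = "{..<n}"])
    have less: "card {u \<in> ?Y. u \<prec>\<^sub>\<omega> v} < card {u \<in> ?Y. u \<prec>\<^sub>\<omega> w}" if "v \<prec>\<^sub>\<omega> w" "v \<in> ?Y" for v w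
    proof (rule psubset_card_mono[OF fin])
      have "u \<prec>\<^sub>\<omega> w" if "u \<prec>\<^sub>\<omega> v" for u using prec_trans[OF that \<open>v \<prec>\<^sub>\<omega> w\<close>] .
      moreover have "v \<in> {u \<in> ?Y. u \<prec>\<^sub>\<omega> w}" "v \<notin> {u \<in> ?Y. u \<prec>\<^sub>\<omega> v}"
        using that prec_irrefl by auto
      ultimately show "{u \<in> ?Y. u \<prec>\<^sub>\<omega> v} \<subset> {u \<in> ?Y. u \<prec>\<^sub>\<omega> w}" by blast
    qed
    show "inj_on (\<lambda>v. card {u \<in> ?Y. u \<prec>\<^sub>\<omega> v}) E"
    proof (rule inj_onI)
      fix v w assume "v \<in> E" "w \<in> E" "card {u \<in> ?Y. u \<prec>\<^sub>\<omega> v} = card {u \<in> ?Y. u \<prec>\<^sub>\<omega> w}"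
      then show "v = w" using less[of v w] less[of w v] prec_total[of v w] by (auto simp: E restr_def)
    qed
  qed (auto simp: E restr_def)
  ultimately show ?thesis using that[OF X] Y by (auto simp: E restr_def)
qed

lemma AR_finite_nonempty: "E \<in> AR k \<Longrightarrow> finite E \<and> E \<noteq> {}"
  by (rule AR_obtain_tree) auto

text \<open>Consecutive members are separated by the nodes \<open>vs\<close>. The separation
  propagates to distant members by induction on \<open>j\<close>, through an element of each
  intermediate member, all of which are nonempty.\<close>

lemma admissible_prec:
  assumes adm: "admissible k d Es" and "i < j" "j < length Es"
    and w: "w \<in> Es ! i" "w' \<in> Es ! j"
  shows "w \<prec>\<^sub>\<omega> w'"
proof -
  obtain vs where vs: "\<And>i. i < length Es \<Longrightarrow> set_leq {vs ! i} (Es ! i)"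
      "\<And>i. Suc i < length Es \<Longrightarrow> set_less (Es ! i) {vs ! Suc i}" and sub: "set Es \<subseteq> AR k"
    using adm unfolding admissible_def by blast
  have sing: "prec_max {v} = v" "prec_min {v} = v" for v
    using prec_max_props(1)[of "{v}"] prec_min_props(1)[of "{v}"] by auto
  have fin: "finite (Es ! i)" "Es ! i \<noteq> {}" if "i < length Es" for i
    using AR_finite_nonempty[of "Es ! i" k] sub nth_mem[OF that] by blast+
  have leq: "vs ! i \<preceq>\<^sub>\<omega> u" if "i < length Es" "u \<in> Es ! i" for i u
    using vs(1)[OF that(1)] prec_min_props(2)[OF fin[OF that(1)] that(2)]
    by (auto simp: set_leq_def sing intro: prec.order_trans)
  have less: "u \<prec>\<^sub>\<omega> vs ! Suc i" if "Suc i < length Es" "u \<in> Es ! i" for i u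
    using vs(2)[OF that(1)] prec_max_props(2)[OF fin that(2)] that(1)
    by (auto simp: set_less_def sing intro: prec.le_less_trans)
  have "\<forall>w'\<in>Es ! j. w \<prec>\<^sub>\<omega> w'" using assms(2,3)
  proof (induction j)
    case (Suc j)
    show ?case
    proof (cases "i = j")
      case True
      then show ?thesis using less[of j w] leq[of "Suc j"] w(1) Suc.prems prec.less_le_trans by blast
    next
      case False
      obtain u where u: "u \<in> Es ! j" using fin[of j] Suc.prems by auto
      then have "w \<prec>\<^sub>\<omega> u" using Suc False by simp
      then show ?thesis
        using less[of j u] leq[of "Suc j"] u Suc.prems prec.less_le_trans prec.less_trans by blast
    qed
  qed simp
  then show ?thesis using w by blast
qed

text \<open>Real suprema over an empty family are unspecified, so the estimates of the norm need at
  least one admissible sequence. The witness is the singleton of the first node, taken from the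
  identity tree.\<close>

lemma admissible_exists:
  assumes "d \<ge> 1"
  shows "\<exists>Es. admissible k d Es"
proof -
  let ?E = "restr 1 (seqs k)"
  have "Ek_tree k (\<lambda>s. s)" by (simp add: Ek_tree_def)
  then have "seqs k \<in> Ek k" unfolding Ek_def by force
  then have E: "?E \<in> ARn k 1" unfolding ARn_def by blast
  then have AR: "?E \<in> AR k" and Ad: "?E \<in> Ad k d" using assms by (auto simp: AR_def Ad_def)
  have fin: "finite {u \<in> seqs k. u \<prec>\<^sub>\<omega> v}" for v
    by (rule finite_subset[OF _ finite_prec_seqs[of k v]]) (auto simp: preceq_def)
  have "{u \<in> seqs k. u \<prec>\<^sub>\<omega> v} = {}" if "card {u \<in> seqs k. u \<prec>\<^sub>\<omega> v} < 1" for v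
    using that card_0_eq[OF fin[of v]] by simp
  then have "v = w" if "v \<in> ?E" "w \<in> ?E" for v w
    using that prec_total[of v w] unfolding restr_def by blast
  moreover have "?E \<noteq> {}" using AR_finite_nonempty[OF AR] by blast
  ultimately obtain v where v: "?E = {v}" by blast
  have "set_leq {v} {v}"
    using prec_max_props(1)[of "{v}"] prec_min_props(1)[of "{v}"] by (simp add: set_leq_def)
  then have "length [v] = length [{v}] \<and> set [v] \<in> Ad k d \<and>
      (\<forall>i<length [{v}]. set_leq {[v] ! i} ([{v}] ! i)) \<and>
      (\<forall>i. Suc i < length [{v}] \<longrightarrow> set_less ([{v}] ! i) {[v] ! Suc i})"
    using Ad v by simp
  then have "admissible k d [{v}]"
    unfolding admissible_def using assms AR v by (intro conjI exI[of _ "[v]"]) auto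
  then show ?thesis by blast
qed

text \<open>
  The nodes of level \<open>length s\<close> of the tree of \<open>E\<close>, except the first one, come after the least element
  of \<open>E\<close>; so if that element comes after \<open>s\<close> and \<open>s'\<close>, only the first node can be \<open>s\<close> or \<open>s'\<close>.
\<close>

lemma AR_meets_one_tree:
  assumes E: "E \<in> AR k" and meet: "\<forall>w\<in>E. v \<preceq>\<^sub>\<omega> w"
    and s: "length s = l" "s \<prec>\<^sub>\<omega> v" "E \<inter> tree_nodes k s \<noteq> {}"
    and s': "length s' = l" "s' \<prec>\<^sub>\<omega> v" "E \<inter> tree_nodes k s' \<noteq> {}"
  shows "s = s'"
proof -
  obtain X where X: "Ek_tree k X" "E \<subseteq> X ` seqs k" "X (replicate k 0) \<in> E"
    by (rule AR_obtain_tree[OF E])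
  \<comment> \<open>Both \<open>s\<close> and \<open>s'\<close> are identified with the same node,
    the image of the zero sequence of length \<open>l\<close>.\<close>
  have *: "r = X (replicate l 0)"
    if r: "length r = l" "r \<prec>\<^sub>\<omega> v" "E \<inter> tree_nodes k r \<noteq> {}" for r
  proof (rule ccontr)
    assume ne: "r \<noteq> X (replicate l 0)"
    obtain t where t: "t \<in> seqs k" and w: "prefix r (X t)" "X t \<in> seqs k"
      using r(3) X(2) by (auto simp: tree_nodes_def)
    have l: "l \<le> k" using prefix_length_le[OF w(1)] w(2) r(1) by (simp add: seqs_def)
    have "r = take l (X t)" using w(1) r(1) by (auto simp: prefix_def)
    then have rX: "r = X (take l t)" using Ek_tree_take[OF X(1) t l] by simp
    have len: "length (take l t) = l" "sorted (take l t)"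
      using t l by (auto simp: seqs_def sorted_wrt_take)
    have "take l t \<noteq> replicate l 0" using ne rX by auto
    \<comment> \<open>Here the zero branch of full length \<open>k\<close> is compared with a node
      of level \<open>l\<close>. Applying \<open>X\<close> places an element of \<open>E\<close>
      before \<open>r\<close>, although \<open>r\<close> precedes \<open>v\<close> and
      \<open>v\<close> precedes or equals all of \<open>E\<close>.\<close>
    then have "replicate k 0 \<prec>\<^sub>\<omega> take l t" using len by (intro replicate_zero_prec) auto
    moreover have "take l t \<in> seqs_le k" using len l by (simp add: seqs_le_def)
    moreover have "replicate k 0 \<in> seqs_le k" using replicate_in_seqs seqs_subset_seqs_le by blast
    ultimately have "X (replicate k 0) \<prec>\<^sub>\<omega> r" using X(1) rX unfolding Ek_tree_def by blast
    moreover have "v \<preceq>\<^sub>\<omega> X (replicate k 0)" using meet X(3) by blast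
    ultimately show False using r(2) by (meson prec.le_less_trans prec.less_asym)
  qed
  show ?thesis using *[OF s] *[OF s'] by simp
qed


section \<open>The norm on finitely supported functions\<close>

context
  fixes k d :: nat and \<theta> :: real
  assumes d: "d \<ge> 1" and \<theta>: "0 < \<theta>" "\<theta> < 1"
begin

text \<open>By \<open>admissible_prec\<close> the members are pairwise disjoint, so after exchanging
  the sums each coordinate is counted at most once.\<close>

lemma sum_proj_le:
  assumes S: "finite S" and adm: "admissible k d Es"
  shows "(\<Sum>E\<leftarrow>Es. \<Sum>w\<in>S. \<bar>proj E x w\<bar>) \<le> (\<Sum>w\<in>S. \<bar>x w\<bar>)"
proof -
  have "(\<Sum>E\<leftarrow>Es. \<Sum>w\<in>S. \<bar>proj E x w\<bar>) = (\<Sum>i<length Es. \<Sum>w\<in>S. \<bar>proj (Es ! i) x w\<bar>)"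
    by (simp add: sum_list_sum_nth atLeast0LessThan)
  also have "\<dots> = (\<Sum>w\<in>S. \<Sum>i<length Es. \<bar>proj (Es ! i) x w\<bar>)"
    by (rule sum.swap)
  also have "\<dots> \<le> (\<Sum>w\<in>S. \<bar>x w\<bar>)"
  proof (rule sum_mono)
    fix w
    let ?I = "{i \<in> {..<length Es}. w \<in> Es ! i}"
    have "i = j" if "i \<in> ?I" "j \<in> ?I" for i j
      using that admissible_prec[OF adm, of i j w w] admissible_prec[OF adm, of j i w w] prec_irrefl
      by (cases i j rule: linorder_cases) auto
    then have "card ?I \<le> Suc 0" by (subst card_le_Suc0_iff_eq) auto
    have "(\<Sum>i<length Es. \<bar>proj (Es ! i) x w\<bar>) = (\<Sum>i\<in>?I. \<bar>x w\<bar>)"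
      by (subst sum.inter_filter) (auto intro!: sum.cong simp: proj_def)
    also have "\<dots> = card ?I * \<bar>x w\<bar>" by simp
    also have "\<dots> \<le> 1 * \<bar>x w\<bar>" using \<open>card ?I \<le> Suc 0\<close> by (intro mult_right_mono) auto
    finally show "(\<Sum>i<length Es. \<bar>proj (Es ! i) x w\<bar>) \<le> \<bar>x w\<bar>" by simp
  qed
  finally show ?thesis .
qed

text \<open>This domination by the \<ell>1 norm makes all the suprema in the definition of the norm
  bounded. It holds because members are disjoint and \<theta> is below 1. The set \<open>S\<close>
  stays fixed in the induction, since it contains the support of every restriction of
  \<open>x\<close> as well.\<close>

lemma T_norm_step_le_sum:
  assumes S: "finite S"
  shows "{w. x w \<noteq> 0} \<subseteq> S \<Longrightarrow> T_norm_step k d \<theta> j x \<le> (\<Sum>w\<in>S. \<bar>x w\<bar>)"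
proof (induction j arbitrary: x)
  case 0
  have "\<bar>x w\<bar> \<le> (\<Sum>w\<in>S. \<bar>x w\<bar>)" for w
  proof (cases "w \<in> S")
    case True
    then show ?thesis using S by (intro member_le_sum) auto
  next
    case False
    then have "x w = 0" using 0 by auto
    then show ?thesis by (simp add: sum_nonneg)
  qed
  then show ?case using replicate_in_seqs by (auto intro!: cSUP_least)
next
  case (Suc j)
  have "(\<Sum>E\<leftarrow>Es. T_norm_step k d \<theta> j (proj E x)) \<le> (\<Sum>w\<in>S. \<bar>x w\<bar>)" if "admissible k d Es" for Es
  proof -
    have "(\<Sum>E\<leftarrow>Es. T_norm_step k d \<theta> j (proj E x)) \<le> (\<Sum>E\<leftarrow>Es. \<Sum>w\<in>S. \<bar>proj E x w\<bar>)"
      using Suc.prems by (intro sum_list_mono Suc.IH) (auto simp: proj_def)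
    also have "\<dots> \<le> (\<Sum>w\<in>S. \<bar>x w\<bar>)" by (rule sum_proj_le[OF S that])
    finally show ?thesis .
  qed
  then have "(SUP Es\<in>{Es. admissible k d Es}. \<Sum>E\<leftarrow>Es. T_norm_step k d \<theta> j (proj E x)) \<le> (\<Sum>w\<in>S. \<bar>x w\<bar>)"
    using admissible_exists[OF d] by (intro cSUP_least) auto
  then have "\<theta> * (SUP Es\<in>{Es. admissible k d Es}. \<Sum>E\<leftarrow>Es. T_norm_step k d \<theta> j (proj E x))
      \<le> \<theta> * (\<Sum>w\<in>S. \<bar>x w\<bar>)"
    using \<theta> by (intro mult_left_mono) auto
  also have "\<dots> \<le> 1 * (\<Sum>w\<in>S. \<bar>x w\<bar>)"
    using \<theta> by (intro mult_right_mono) (auto simp: sum_nonneg)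
  finally show ?case using Suc.IH[OF Suc.prems] by simp
qed

lemma bdd_above_admissible:
  assumes "finite {w. x w \<noteq> 0}"
  shows "bdd_above ((\<lambda>Es. \<Sum>E\<leftarrow>Es. T_norm_step k d \<theta> j (proj E x)) ` {Es. admissible k d Es})"
proof (rule bdd_aboveI2)
  fix Es assume "Es \<in> {Es. admissible k d Es}"
  have "(\<Sum>E\<leftarrow>Es. T_norm_step k d \<theta> j (proj E x))
      \<le> (\<Sum>E\<leftarrow>Es. \<Sum>w\<in>{w. x w \<noteq> 0}. \<bar>proj E x w\<bar>)"
    by (intro sum_list_mono T_norm_step_le_sum[OF assms]) (auto simp: proj_def)
  also have "\<dots> \<le> (\<Sum>w\<in>{w. x w \<noteq> 0}. \<bar>x w\<bar>)"
    using \<open>Es \<in> _\<close> by (intro sum_proj_le[OF assms]) auto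
  finally show "(\<Sum>E\<leftarrow>Es. T_norm_step k d \<theta> j (proj E x)) \<le> (\<Sum>w\<in>{w. x w \<noteq> 0}. \<bar>x w\<bar>)" .
qed

lemma finite_support_proj: "finite {w. x w \<noteq> 0} \<Longrightarrow> finite {w. proj E x w \<noteq> 0}"
  by (rule finite_subset[of _ "{w. x w \<noteq> 0}"]) (auto simp: proj_def)

lemma bdd_above_coords:
  assumes "finite {w. x w \<noteq> (0::real)}"
  shows "bdd_above ((\<lambda>w. \<bar>x w\<bar>) ` A)"
proof (rule bdd_above_mono)
  \<comment> \<open>All coordinates off the support equal \<open>0\<close>, so one extra value makes
    the image finite.\<close>
  show "bdd_above (insert 0 ((\<lambda>w. \<bar>x w\<bar>) ` {w. x w \<noteq> 0}))" using assms by (intro bdd_above_finite) auto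
qed force

lemma abs_le_T_norm_step:
  assumes "finite {w. x w \<noteq> 0}" "w \<in> seqs k"
  shows "\<bar>x w\<bar> \<le> T_norm_step k d \<theta> j x"
proof (induction j)
  case 0
  then show ?case using cSUP_upper[OF assms(2) bdd_above_coords[OF assms(1)]] by simp
qed (auto simp: le_max_iff_disj)

lemma T_norm_step_nonneg:
  assumes "finite {w. x w \<noteq> 0}"
  shows "0 \<le> T_norm_step k d \<theta> j x"
  using abs_le_T_norm_step[OF assms replicate_in_seqs, of j] by (meson abs_ge_zero order_trans)

text \<open>This is 1-unconditionality in monotone form: domination of absolute values is inherited
  by restrictions, so the induction passes through every admissible sum.\<close>

lemma T_norm_step_mono:
  assumes "finite {w. y w \<noteq> 0}" "\<And>w. \<bar>x w\<bar> \<le> \<bar>y w\<bar>"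
  shows "T_norm_step k d \<theta> j x \<le> T_norm_step k d \<theta> j y"
  using assms
proof (induction j arbitrary: x y)
  case 0
  then show ?case using replicate_in_seqs bdd_above_coords[OF 0(1)] by (auto intro!: cSUP_mono)
next
  case (Suc j)
  have "(SUP Es\<in>{Es. admissible k d Es}. \<Sum>E\<leftarrow>Es. T_norm_step k d \<theta> j (proj E x))
      \<le> (SUP Es\<in>{Es. admissible k d Es}. \<Sum>E\<leftarrow>Es. T_norm_step k d \<theta> j (proj E y))"
  proof (rule cSUP_mono)
    fix Es assume "Es \<in> {Es. admissible k d Es}"
    moreover have "(\<Sum>E\<leftarrow>Es. T_norm_step k d \<theta> j (proj E x)) \<le> (\<Sum>E\<leftarrow>Es. T_norm_step k d \<theta> j (proj E y))"
      using Suc.prems by (intro sum_list_mono Suc.IH finite_support_proj) (auto simp: proj_def)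
    ultimately show "\<exists>Fs\<in>{Es. admissible k d Es}. (\<Sum>E\<leftarrow>Es. T_norm_step k d \<theta> j (proj E x))
        \<le> (\<Sum>E\<leftarrow>Fs. T_norm_step k d \<theta> j (proj E y))" by blast
  qed (use admissible_exists[OF d] bdd_above_admissible[OF Suc.prems(1)] in auto)
  then have "\<theta> * (SUP Es\<in>{Es. admissible k d Es}. \<Sum>E\<leftarrow>Es. T_norm_step k d \<theta> j (proj E x))
      \<le> \<theta> * (SUP Es\<in>{Es. admissible k d Es}. \<Sum>E\<leftarrow>Es. T_norm_step k d \<theta> j (proj E y))"
    using \<theta> by (intro mult_left_mono) auto
  with Suc.IH[OF Suc.prems] show ?case unfolding T_norm_step.simps by (rule max.mono)
qed

lemma T_norm_step_le_T_norm:
  assumes "finite {w. x w \<noteq> 0}"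
  shows "T_norm_step k d \<theta> j x \<le> T_norm k d \<theta> x"
  unfolding T_norm_def
  by (rule cSUP_upper) (auto intro!: bdd_aboveI2 T_norm_step_le_sum[OF assms])

lemma T_norm_leI: "(\<And>j. T_norm_step k d \<theta> j x \<le> B) \<Longrightarrow> T_norm k d \<theta> x \<le> B"
  unfolding T_norm_def by (rule cSUP_least) auto

lemma T_norm_mono:
  assumes "finite {w. y w \<noteq> 0}" "\<And>w. \<bar>x w\<bar> \<le> \<bar>y w\<bar>"
  shows "T_norm k d \<theta> x \<le> T_norm k d \<theta> y"
  by (meson T_norm_leI T_norm_step_mono[OF assms] T_norm_step_le_T_norm[OF assms(1)] order_trans)

lemma abs_le_T_norm:
  assumes "finite {w. x w \<noteq> 0}" "w \<in> seqs k"
  shows "\<bar>x w\<bar> \<le> T_norm k d \<theta> x"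
  using abs_le_T_norm_step[OF assms, of 0] T_norm_step_le_T_norm[OF assms(1), of 0] by linarith

lemma T_norm_nonneg: "finite {w. x w \<noteq> 0} \<Longrightarrow> 0 \<le> T_norm k d \<theta> x"
  using T_norm_step_nonneg[of x 0] T_norm_step_le_T_norm[of x 0] by linarith

text \<open>Clearing the positive denominator turns the claim into
  \<open>1 \<le> \<theta> * d\<close>. It starts the induction of the upper estimate and makes the
  isomorphism constant positive.\<close>

lemma one_le_constant: "real d * \<theta> > 1 \<Longrightarrow> 1 \<le> \<theta> * (real d - 1) / (1 - \<theta>)"
  using \<theta> by (simp add: field_simps)

section \<open>The upper estimate for finitely supported vectors on trees\<close>

context
  fixes R :: "nat list set" and v :: "nat list" and l :: nat and M C :: real
  assumes d\<theta>: "real d * \<theta> > 1"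
    and R: "R \<noteq> {}" "\<And>r. r \<in> R \<Longrightarrow> length r = l" "\<And>r. r \<in> R \<Longrightarrow> r \<prec>\<^sub>\<omega> v"
  defines "C \<equiv> \<theta> * (real d - 1) / (1 - \<theta>)"
begin

lemma one_le_C: "1 \<le> C"
  unfolding C_def by (rule one_le_constant[OF d\<theta>])

text \<open>The three hypotheses pass from \<open>u\<close> to each restriction
  \<open>proj E u\<close>; hence \<open>u\<close> is kept arbitrary, and the induction hypothesis
  applies to the members of an admissible sequence.\<close>

lemma T_norm_step_trees_le:
  assumes "finite {w. u w \<noteq> 0}"
    and "\<And>w. u w \<noteq> 0 \<Longrightarrow> v \<prec>\<^sub>\<omega> w \<and> (\<exists>r\<in>R. w \<in> tree_nodes k r)"
    and "\<And>r. r \<in> R \<Longrightarrow> T_norm k d \<theta> (proj (tree_nodes k r) u) \<le> M"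
  shows "T_norm_step k d \<theta> j u \<le> C * M"
  using assms
proof (induction j arbitrary: u)
  case (0 u)
  \<comment> \<open>Nonemptiness of \<open>R\<close> gives \<open>0 \<le> M\<close>, since
    \<open>M\<close> bounds a norm.\<close>
  obtain r0 where "r0 \<in> R" using R by blast
  have "0 \<le> M"
    using 0(3)[OF \<open>r0 \<in> R\<close>] T_norm_nonneg[OF finite_support_proj[OF 0(1), of "tree_nodes k r0"]] by linarith
  then have M: "M \<le> C * M" using one_le_C mult_right_mono[of 1 C M] by simp
  have "\<bar>u w\<bar> \<le> C * M" for w
  proof (cases "u w = 0")
    case True
    then show ?thesis using M \<open>0 \<le> M\<close> by simp
  next
    case False
    then obtain r where r: "r \<in> R" "w \<in> tree_nodes k r" using 0(2) by blast
    then have "\<bar>u w\<bar> \<le> T_norm k d \<theta> (proj (tree_nodes k r) u)"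
      using abs_le_T_norm[OF finite_support_proj[OF 0(1)], of w "tree_nodes k r"]
      by (simp add: proj_def tree_nodes_def)
    then show ?thesis using 0(3)[OF r(1)] M by linarith
  qed
  then show ?case using replicate_in_seqs by (auto intro!: cSUP_least)
next
  case (Suc j u)
  obtain r0 where "r0 \<in> R" using R by blast
  have "0 \<le> M"
    using Suc(4)[OF \<open>r0 \<in> R\<close>] T_norm_nonneg[OF finite_support_proj[OF Suc(2), of "tree_nodes k r0"]] by linarith
  \<comment> \<open>One exceptional member is charged \<open>C * M\<close>, each of the at most
    \<open>d - 1\<close> others \<open>M\<close>.\<close>
  have "(\<Sum>E\<leftarrow>Es. T_norm_step k d \<theta> j (proj E u)) \<le> C * M + (real d - 1) * M"
    if adm: "admissible k d Es" for Es
  proof -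
    let ?m = "length Es"
    define f where "f i = T_norm_step k d \<theta> j (proj (Es ! i) u)" for i
    have AR: "Es ! i \<in> AR k" if "i < ?m" for i
      using adm nth_mem[OF that] unfolding admissible_def by blast
    have m: "1 \<le> ?m" "?m \<le> d" using adm by (auto simp: admissible_def)
    have fC: "f i \<le> C * M" for i
      unfolding f_def
    proof (rule Suc.IH)
      show "finite {w. proj (Es ! i) u w \<noteq> 0}" by (rule finite_support_proj[OF Suc.prems(1)])
      show "v \<prec>\<^sub>\<omega> w \<and> (\<exists>r\<in>R. w \<in> tree_nodes k r)" if "proj (Es ! i) u w \<noteq> 0" for w
        using that Suc.prems(2) by (auto simp: proj_def split: if_splits)
      show "T_norm k d \<theta> (proj (tree_nodes k r) (proj (Es ! i) u)) \<le> M" if "r \<in> R" for r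
        by (rule order_trans[OF T_norm_mono Suc.prems(3)[OF that]])
          (rule finite_support_proj[OF Suc.prems(1)], simp add: proj_def)
    qed
    \<comment> \<open>A member contributing more than \<open>M\<close> straddles \<open>v\<close>.
      It meets the support, hence has a node after \<open>v\<close>; if it had none before
      \<open>v\<close>, \<open>AR_meets_one_tree\<close> would confine its part of the support to a
      single tree, where \<open>M\<close> is a bound.\<close>
    have bad: "(\<exists>w\<in>Es ! i. v \<prec>\<^sub>\<omega> w) \<and> (\<exists>w\<in>Es ! i. w \<prec>\<^sub>\<omega> v)" if i: "i < ?m" and "\<not> f i \<le> M" for i
    proof -
      have "\<exists>w\<in>Es ! i. u w \<noteq> 0"
      proof (rule ccontr)
        assume "\<not> (\<exists>w\<in>Es ! i. u w \<noteq> 0)"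
        then have "proj (Es ! i) u = (\<lambda>w. 0)" by (auto simp: proj_def)
        then have "f i \<le> 0"
          unfolding f_def using T_norm_step_le_sum[of "{}" "\<lambda>w. 0" j] by simp
        then show False using \<open>0 \<le> M\<close> that(2) by simp
      qed
      then obtain w where w: "w \<in> Es ! i" "u w \<noteq> 0" by blast
      then obtain r where r: "r \<in> R" "w \<in> tree_nodes k r" and "v \<prec>\<^sub>\<omega> w" using Suc.prems(2) by blast
      have "\<exists>w\<in>Es ! i. w \<prec>\<^sub>\<omega> v"
      proof (rule ccontr)
        assume "\<not> (\<exists>w\<in>Es ! i. w \<prec>\<^sub>\<omega> v)"
        then have after: "\<forall>w\<in>Es ! i. v \<preceq>\<^sub>\<omega> w" by (simp add: prec.not_less)
        have "w' \<in> tree_nodes k r" if w': "w' \<in> Es ! i" "u w' \<noteq> 0" for w'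
        proof -
          obtain r' where r': "r' \<in> R" "w' \<in> tree_nodes k r'" using Suc.prems(2)[OF w'(2)] by blast
          have "r = r'"
            by (rule AR_meets_one_tree[OF AR[OF i] after R(2)[OF r(1)] R(3)[OF r(1)] _ R(2)[OF r'(1)] R(3)[OF r'(1)]])
              (use w w' r r' in blast)+
          then show ?thesis using r' by simp
        qed
        then have "f i \<le> T_norm_step k d \<theta> j (proj (tree_nodes k r) u)"
          unfolding f_def by (intro T_norm_step_mono finite_support_proj Suc.prems(1)) (auto simp: proj_def)
        also have "\<dots> \<le> T_norm k d \<theta> (proj (tree_nodes k r) u)"
          by (intro T_norm_step_le_T_norm finite_support_proj Suc.prems(1))
        also have "\<dots> \<le> M" by (rule Suc.prems(3)[OF r(1)])
        finally show False using that(2) by simp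
      qed
      then show ?thesis using w(1) \<open>v \<prec>\<^sub>\<omega> w\<close> by blast
    qed
    \<comment> \<open>Of two straddling members, the earlier one would have a node after
      \<open>v\<close> and the later one a node before \<open>v\<close>, against the order of the
      members.\<close>
    have bad_unique: "\<not> i < i'" if "i < ?m" "i' < ?m" "\<not> f i \<le> M" "\<not> f i' \<le> M" for i i'
    proof
      assume "i < i'"
      obtain w w' where "w \<in> Es ! i" "v \<prec>\<^sub>\<omega> w" "w' \<in> Es ! i'" "w' \<prec>\<^sub>\<omega> v"
        using bad[of i] bad[of i'] \<open>i < ?m\<close> \<open>i' < ?m\<close> \<open>\<not> f i \<le> M\<close> \<open>\<not> f i' \<le> M\<close> by blast
      moreover from this have "w \<prec>\<^sub>\<omega> w'"
        using admissible_prec[OF adm \<open>i < i'\<close> \<open>i' < ?m\<close>] by blast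
      ultimately show False by (meson prec.less_asym prec.less_trans)
    qed
    have "\<exists>i0<?m. \<forall>i<?m. i \<noteq> i0 \<longrightarrow> f i \<le> M"
    proof (cases "\<exists>i<?m. \<not> f i \<le> M")
      case True
      then show ?thesis using bad_unique by (metis linorder_neqE_nat)
    next
      case False
      \<comment> \<open>With no straddling member, index \<open>0\<close> serves as the exceptional
        one; the bound \<open>fC\<close> holds for every index.\<close>
      then show ?thesis using m by (intro exI[of _ 0]) auto
    qed
    then obtain i0 where i0: "i0 < ?m" "\<And>i. i < ?m \<Longrightarrow> i \<noteq> i0 \<Longrightarrow> f i \<le> M" by blast
    have "(\<Sum>E\<leftarrow>Es. T_norm_step k d \<theta> j (proj E u)) = (\<Sum>i<?m. f i)"
      by (simp add: sum_list_sum_nth atLeast0LessThan f_def)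
    also have "\<dots> = f i0 + (\<Sum>i\<in>{..<?m} - {i0}. f i)"
      using i0(1) by (intro sum.remove) auto
    also have "\<dots> \<le> C * M + (\<Sum>i\<in>{..<?m} - {i0}. M)"
      using fC i0(2) by (intro add_mono sum_mono) auto
    also have "(\<Sum>i\<in>{..<?m} - {i0}. M) = (real ?m - 1) * M"
      using i0(1) by (simp add: of_nat_diff)
    also have "\<dots> \<le> (real d - 1) * M" using m \<open>0 \<le> M\<close> by (intro mult_right_mono) auto
    finally show ?thesis by simp
  qed
  then have "(SUP Es\<in>{Es. admissible k d Es}. \<Sum>E\<leftarrow>Es. T_norm_step k d \<theta> j (proj E u))
      \<le> C * M + (real d - 1) * M"
    using admissible_exists[OF d] by (intro cSUP_least) auto
  then have "\<theta> * (SUP Es\<in>{Es. admissible k d Es}. \<Sum>E\<leftarrow>Es. T_norm_step k d \<theta> j (proj E u))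
      \<le> \<theta> * (C * M + (real d - 1) * M)"
    using \<theta> by (intro mult_left_mono) auto
  \<comment> \<open>\<open>C\<close> is the solution of
    \<open>\<theta> * (C + (d - 1)) = C\<close>.\<close>
  also have "\<dots> = C * M" using \<theta> by (simp add: C_def field_simps)
  finally show ?case using Suc.IH[OF Suc.prems] by simp
qed

lemmas T_norm_trees_le = T_norm_leI[OF T_norm_step_trees_le]

end

end

section \<open>Coordinates in the completion\<close>

definition c00_on :: "nat \<Rightarrow> nat list set \<Rightarrow> (nat list \<Rightarrow> real) set" where
  "c00_on k A = {x \<in> c00 k. {w. x w \<noteq> 0} \<subseteq> A}"

lemma c00_onI: "x \<in> c00 k \<Longrightarrow> (\<And>w. x w \<noteq> 0 \<Longrightarrow> w \<in> A) \<Longrightarrow> x \<in> c00_on k A"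
  by (auto simp: c00_on_def)

lemma c00_onD: "x \<in> c00_on k A \<Longrightarrow> x w \<noteq> 0 \<Longrightarrow> w \<in> A"
  by (auto simp: c00_on_def)

lemma c00_on_c00: "x \<in> c00_on k A \<Longrightarrow> x \<in> c00 k"
  by (simp add: c00_on_def)

lemma c00_add: "x \<in> c00 k \<Longrightarrow> y \<in> c00 k \<Longrightarrow> (\<lambda>w. x w + y w) \<in> c00 k"
proof -
  assume "x \<in> c00 k" "y \<in> c00 k"
  moreover have "{w. x w + y w \<noteq> 0} \<subseteq> {w. x w \<noteq> 0} \<union> {w. y w \<noteq> 0}" by auto
  ultimately show ?thesis
    unfolding c00_def using finite_subset[of "{w. x w + y w \<noteq> 0}" "{w. x w \<noteq> 0} \<union> {w. y w \<noteq> 0}"]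
    by blast
qed

lemma c00_scale: "x \<in> c00 k \<Longrightarrow> (\<lambda>w. c * x w) \<in> c00 k"
  unfolding c00_def by (auto intro: finite_subset[of _ "{w. x w \<noteq> 0}"])

lemma c00_diff: "x \<in> c00 k \<Longrightarrow> y \<in> c00 k \<Longrightarrow> (\<lambda>w. x w - y w) \<in> c00 k"
  using c00_add[of x k "\<lambda>w. (-1) * y w"] c00_scale[of y k "-1"] by simp

lemma c00_proj: "x \<in> c00 k \<Longrightarrow> proj E x \<in> c00 k"
  unfolding c00_def by (auto intro: finite_subset[of _ "{w. x w \<noteq> 0}"] simp: proj_def)

lemma proj_in_c00: "finite F \<Longrightarrow> F \<subseteq> seqs k \<Longrightarrow> proj F a \<in> c00 k"
  unfolding c00_def by (auto intro: finite_subset[of _ F] simp: proj_def)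

lemma c00_sum: "finite I \<Longrightarrow> (\<And>i. i \<in> I \<Longrightarrow> u i \<in> c00 k) \<Longrightarrow> (\<lambda>w. \<Sum>i\<in>I. u i w) \<in> c00 k"
proof (induction I rule: finite_induct)
  case empty
  then show ?case by (simp add: c00_def)
next
  case (insert i I)
  then show ?case using c00_add[of "u i" k "\<lambda>w. \<Sum>i\<in>I. u i w"] by simp
qed

lemma indicator_in_c00: "w \<in> seqs k \<Longrightarrow> indicator {w} \<in> c00 k"
  unfolding c00_def by (auto intro: finite_subset[of _ "{w}"] simp: indicator_def)

lemma finite_support_c00: "x \<in> c00 k \<Longrightarrow> finite {w. x w \<noteq> 0}"
  by (simp add: c00_def)

context
  fixes k d :: nat and \<theta> :: real
    and \<iota> :: "(nat list \<Rightarrow> real) \<Rightarrow> 'b::real_normed_vector" and T :: "'b set"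
  assumes d: "d \<ge> 1" and \<theta>: "0 < \<theta>" "\<theta> < 1" and T: "T_completion k d \<theta> \<iota> T"
begin

lemma iota_add: "x \<in> c00 k \<Longrightarrow> y \<in> c00 k \<Longrightarrow> \<iota> (\<lambda>w. x w + y w) = \<iota> x + \<iota> y"
  using T unfolding T_completion_def by blast

lemma iota_scale: "x \<in> c00 k \<Longrightarrow> \<iota> (\<lambda>w. c * x w) = c *\<^sub>R \<iota> x"
  using T unfolding T_completion_def by blast

lemma norm_iota: "x \<in> c00 k \<Longrightarrow> norm (\<iota> x) = T_norm k d \<theta> x"
  using T unfolding T_completion_def by blast

lemma iota_zero: "\<iota> (\<lambda>w. 0) = 0"
  using iota_scale[of "\<lambda>w. 0" 0] by (simp add: c00_def)

lemma iota_diff: "x \<in> c00 k \<Longrightarrow> y \<in> c00 k \<Longrightarrow> \<iota> (\<lambda>w. x w - y w) = \<iota> x - \<iota> y"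
  using iota_add[of x "\<lambda>w. (-1) * y w"] iota_scale[of y "-1"] c00_scale[of y k "-1"] by simp

lemma iota_sum:
  "finite I \<Longrightarrow> (\<And>i. i \<in> I \<Longrightarrow> u i \<in> c00 k) \<Longrightarrow> \<iota> (\<lambda>w. \<Sum>i\<in>I. u i w) = (\<Sum>i\<in>I. \<iota> (u i))"
proof (induction I rule: finite_induct)
  case (insert i I)
  then show ?case using iota_add[of "u i" "\<lambda>w. \<Sum>i\<in>I. u i w"] c00_sum[of I u k] by simp
qed (simp add: iota_zero)

text \<open>Identifies finite partial sums of a basis expansion with images of finitely supported
  functions, for which the norm estimates are available.\<close>

lemma iota_proj_finite:
  assumes "finite F" "F \<subseteq> seqs k"
  shows "\<iota> (proj F a) = (\<Sum>w\<in>F. a w *\<^sub>R basis_vec \<iota> w)"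
proof -
  have eq: "proj F a = (\<lambda>w. \<Sum>i\<in>F. a i * indicator {i} w)"
    using assms(1) by (auto simp: proj_def indicator_def fun_eq_iff if_distrib[of "(*) _"] cong: if_cong)
  have "\<iota> (\<lambda>w. \<Sum>i\<in>F. a i * indicator {i} w) = (\<Sum>i\<in>F. \<iota> (\<lambda>w. a i * indicator {i} w))"
    using assms by (intro iota_sum c00_scale indicator_in_c00) auto
  also have "\<dots> = (\<Sum>w\<in>F. a w *\<^sub>R basis_vec \<iota> w)"
    using assms unfolding basis_vec_def by (intro sum.cong refl iota_scale indicator_in_c00) auto
  finally show ?thesis by (simp only: eq)
qed

lemma abs_le_norm_iota:
  assumes "x \<in> c00 k"
  shows "\<bar>x w\<bar> \<le> norm (\<iota> x)"
proof (cases "w \<in> seqs k")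
  case True
  then show ?thesis
    using abs_le_T_norm[OF d \<theta> finite_support_c00[OF assms]] norm_iota[OF assms] by simp
next
  case False
  then have "x w = 0" using assms by (auto simp: c00_def)
  then show ?thesis by simp
qed

lemma norm_iota_proj_le:
  assumes "x \<in> c00 k"
  shows "norm (\<iota> (proj E x)) \<le> norm (\<iota> x)"
  unfolding norm_iota[OF assms] norm_iota[OF c00_proj[OF assms]]
  by (rule T_norm_mono[OF d \<theta> finite_support_c00[OF assms]]) (simp add: proj_def)

text \<open>On images of \<open>c00 k\<close> each coordinate is bounded by the norm; partial sums
  carry this over to any expansion \<open>b\<close> of \<open>z\<close>. Uniqueness of the expansion
  is not presupposed but deduced from this.\<close>

lemma has_sum_coord_diff_le:
  assumes b: "((\<lambda>w. b w *\<^sub>R basis_vec \<iota> w) has_sum z) (seqs k)"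
    and x: "x \<in> c00 k" and w: "w \<in> seqs k"
  shows "\<bar>x w - b w\<bar> \<le> norm (\<iota> x - z)"
proof (rule field_le_epsilon)
  fix e :: real assume "0 < e"
  then have "eventually (\<lambda>F. dist (\<Sum>w\<in>F. b w *\<^sub>R basis_vec \<iota> w) z < e) (finite_subsets_at_top (seqs k))"
    using b unfolding has_sum_def tendsto_iff by blast
  then obtain F where "finite F \<and> F \<subseteq> seqs k \<and> (\<forall>G. finite G \<and> F \<subseteq> G \<and> G \<subseteq> seqs k \<longrightarrow>
      dist (\<Sum>w\<in>G. b w *\<^sub>R basis_vec \<iota> w) z < e)"
    unfolding eventually_finite_subsets_at_top by (elim exE)
  then have F: "finite F" "F \<subseteq> seqs k"
    and F': "\<And>G. finite G \<Longrightarrow> F \<subseteq> G \<Longrightarrow> G \<subseteq> seqs k \<Longrightarrow> dist (\<Sum>w\<in>G. b w *\<^sub>R basis_vec \<iota> w) z < e"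
    by simp_all
  \<comment> \<open>Adding \<open>w\<close> makes the coordinate of the partial sum at
    \<open>w\<close> equal to \<open>b w\<close>.\<close>
  let ?G = "insert w F"
  have G: "finite ?G" "?G \<subseteq> seqs k" using F w by auto
  have "\<bar>x w - b w\<bar> = \<bar>x w - proj ?G b w\<bar>" by (simp add: proj_def)
  also have "\<dots> \<le> norm (\<iota> (\<lambda>w. x w - proj ?G b w))"
    by (rule abs_le_norm_iota) (intro c00_diff x proj_in_c00 G)
  also have "\<dots> = norm (\<iota> x - (\<Sum>w\<in>?G. b w *\<^sub>R basis_vec \<iota> w))"
    using iota_diff[OF x proj_in_c00[OF G]] iota_proj_finite[OF G] by simp
  also have "\<dots> \<le> norm (\<iota> x - z) + dist (\<Sum>w\<in>?G. b w *\<^sub>R basis_vec \<iota> w) z"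
    using norm_triangle_ineq[of "\<iota> x - z" "z - (\<Sum>w\<in>?G. b w *\<^sub>R basis_vec \<iota> w)"]
    by (simp add: dist_norm norm_minus_commute)
  also have "\<dots> \<le> norm (\<iota> x - z) + e" using F'[OF G(1) _ G(2)] by fastforce
  finally show "\<bar>x w - b w\<bar> \<le> norm (\<iota> x - z) + e" .
qed

lemma tendsto_coord_has_sum:
  assumes u: "\<And>n. u n \<in> c00 k" "(\<lambda>n. \<iota> (u n)) \<longlonglongrightarrow> z"
    and b: "((\<lambda>w. b w *\<^sub>R basis_vec \<iota> w) has_sum z) (seqs k)" and w: "w \<in> seqs k"
  shows "(\<lambda>n. u n w) \<longlonglongrightarrow> b w"
proof -
  have "(\<lambda>n. norm (\<iota> (u n) - z)) \<longlonglongrightarrow> 0"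
    using u(2) by (simp add: LIM_zero tendsto_norm_zero)
  then have "(\<lambda>n. u n w - b w) \<longlonglongrightarrow> 0"
    by (rule Lim_null_comparison[rotated]) (use has_sum_coord_diff_le[OF b u(1) w] in simp)
  then show ?thesis by (rule LIM_zero_cancel)
qed

text \<open>Existence of the expansion: coordinates of approximants are Cauchy, and restriction to
  any set is a contraction, uniformly in the set, so convergence of the vectors controls all large
  partial sums.\<close>

lemma has_sum_limits:
  assumes u: "\<And>n. u n \<in> c00 k" "(\<lambda>n. \<iota> (u n)) \<longlonglongrightarrow> z"
  shows "((\<lambda>w. lim (\<lambda>n. u n w) *\<^sub>R basis_vec \<iota> w) has_sum z) (seqs k)"
proof -
  define a where "a w = lim (\<lambda>n. u n w)" for w
  have a: "(\<lambda>n. u n w) \<longlonglongrightarrow> a w" for w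
  proof -
    have "Cauchy (\<lambda>n. u n w)"
      unfolding Cauchy_iff
    proof (intro allI impI)
      fix e :: real assume "0 < e"
      then obtain K where K: "\<And>m n. m \<ge> K \<Longrightarrow> n \<ge> K \<Longrightarrow> norm (\<iota> (u m) - \<iota> (u n)) < e"
        using LIMSEQ_imp_Cauchy[OF u(2)] unfolding Cauchy_iff by blast
      have "norm (u m w - u n w) < e" if "m \<ge> K" "n \<ge> K" for m n
        using abs_le_norm_iota[OF c00_diff[OF u(1)[of m] u(1)[of n]], of w] iota_diff[OF u(1)[of m] u(1)[of n]] K[OF that]
        by simp
      then show "\<exists>M. \<forall>m\<ge>M. \<forall>n\<ge>M. norm (u m w - u n w) < e" by blast
    qed
    then show ?thesis unfolding a_def by (simp add: Cauchy_convergent_iff convergent_LIMSEQ_iff)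
  qed
  \<comment> \<open>Restrict \<open>u n - u m\<close> to \<open>F\<close>, which leaves
    \<open>u m\<close> unchanged, and let \<open>n\<close> tend to infinity.\<close>
  have bound: "norm ((\<Sum>w\<in>F. a w *\<^sub>R basis_vec \<iota> w) - \<iota> (u m)) \<le> norm (z - \<iota> (u m))"
    if F: "finite F" "F \<subseteq> seqs k" "{w. u m w \<noteq> 0} \<subseteq> F" for F m
  proof (rule LIMSEQ_le)
    have "(\<lambda>n. \<Sum>w\<in>F. u n w *\<^sub>R basis_vec \<iota> w) \<longlonglongrightarrow> (\<Sum>w\<in>F. a w *\<^sub>R basis_vec \<iota> w)"
      by (intro tendsto_intros a)
    then show "(\<lambda>n. norm (\<iota> (proj F (u n)) - \<iota> (u m)))
        \<longlonglongrightarrow> norm ((\<Sum>w\<in>F. a w *\<^sub>R basis_vec \<iota> w) - \<iota> (u m))"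
      by (intro tendsto_intros) (simp add: iota_proj_finite[OF F(1,2)])
    show "(\<lambda>n. norm (\<iota> (u n) - \<iota> (u m))) \<longlonglongrightarrow> norm (z - \<iota> (u m))"
      by (intro tendsto_intros u(2))
    have "norm (\<iota> (proj F (u n)) - \<iota> (u m)) \<le> norm (\<iota> (u n) - \<iota> (u m))" for n
    proof -
      have "proj F (\<lambda>w. u n w - u m w) = (\<lambda>w. proj F (u n) w - u m w)"
        using F(3) by (auto simp: proj_def fun_eq_iff)
      then show ?thesis
        using norm_iota_proj_le[OF c00_diff[OF u(1)[of n] u(1)[of m]], of F]
        by (simp add: iota_diff u(1) c00_proj)
    qed
    then show "\<exists>K. \<forall>n\<ge>K. norm (\<iota> (proj F (u n)) - \<iota> (u m)) \<le> norm (\<iota> (u n) - \<iota> (u m))" by blast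
  qed
  have "((\<lambda>w. a w *\<^sub>R basis_vec \<iota> w) has_sum z) (seqs k)"
    unfolding has_sum_def tendsto_iff
  proof (intro allI impI)
    fix e :: real assume "0 < e"
    \<comment> \<open>The support of this single approximant is the finite set beyond which all
      partial sums lie within \<open>e\<close> of \<open>z\<close>: half from \<open>bound\<close>,
      half from \<open>u m\<close> itself.\<close>
    then obtain m where m: "dist (\<iota> (u m)) z < e / 2"
      using u(2) unfolding lim_sequentially by (metis half_gt_zero order_refl)
    have "dist (\<Sum>w\<in>F. a w *\<^sub>R basis_vec \<iota> w) z < e"
      if F: "finite F" "{w. u m w \<noteq> 0} \<subseteq> F" "F \<subseteq> seqs k" for F
    proof -
      have "dist (\<Sum>w\<in>F. a w *\<^sub>R basis_vec \<iota> w) z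
          \<le> dist (\<Sum>w\<in>F. a w *\<^sub>R basis_vec \<iota> w) (\<iota> (u m)) + dist (\<iota> (u m)) z"
        by (rule dist_triangle)
      also have "dist (\<Sum>w\<in>F. a w *\<^sub>R basis_vec \<iota> w) (\<iota> (u m)) \<le> dist (\<iota> (u m)) z"
        using bound[OF F(1,3,2)] by (simp add: dist_norm norm_minus_commute)
      finally show ?thesis using m by simp
    qed
    then show "eventually (\<lambda>F. dist (\<Sum>w\<in>F. a w *\<^sub>R basis_vec \<iota> w) z < e) (finite_subsets_at_top (seqs k))"
      unfolding eventually_finite_subsets_at_top using u(1)[of m]
      by (intro exI[of _ "{w. u m w \<noteq> 0}"]) (auto simp: c00_def)
  qed
  then show ?thesis unfolding a_def .
qed

text \<open>Here the description defining \<open>coords\<close> is resolved: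
  \<open>has_sum_limits\<close> gives existence, and \<open>tendsto_coord_has_sum\<close> forces any
  two expansions to agree.\<close>

lemma tendsto_coords:
  assumes u: "\<And>n. u n \<in> c00 k" "(\<lambda>n. \<iota> (u n)) \<longlonglongrightarrow> z" and w: "w \<in> seqs k"
  shows "(\<lambda>n. u n w) \<longlonglongrightarrow> coords k \<iota> z w"
proof -
  let ?P = "\<lambda>a. (\<forall>v. v \<notin> seqs k \<longrightarrow> a v = 0) \<and> ((\<lambda>v. a v *\<^sub>R basis_vec \<iota> v) has_sum z) (seqs k)"
  let ?a = "\<lambda>w. lim (\<lambda>n. u n w)"
  have "u n v = 0" if "v \<notin> seqs k" for n v using u(1)[of n] that by (auto simp: c00_def)
  then have Pa: "?P ?a" using has_sum_limits[OF u] by simp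
  have "b = ?a" if "?P b" for b
  proof
    fix v show "b v = ?a v"
    proof (cases "v \<in> seqs k")
      case True
      have "(\<lambda>n. u n v) \<longlonglongrightarrow> b v" "(\<lambda>n. u n v) \<longlonglongrightarrow> ?a v"
        using tendsto_coord_has_sum[OF u _ True] conjunct2[OF that] conjunct2[OF Pa] by simp_all
      then show ?thesis by (rule LIMSEQ_unique)
    qed (use that Pa in auto)
  qed
  then have "coords k \<iota> z = ?a" unfolding coords_def 
    by (intro the_equality Pa)
  then show ?thesis using tendsto_coord_has_sum[OF u conjunct2[OF Pa] w] by simp
qed

section \<open>Approximation of tree subspaces by finitely supported vectors\<close>

text \<open>The images of finitely supported functions on the tree form a subspace containing the
  basis vectors of the tree, hence their span.\<close>

lemma tree_subspace_closure: "tree_subspace k \<iota> s \<subseteq> closure (\<iota> ` c00_on k (tree_nodes k s))"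
proof -
  let ?A = "tree_nodes k s"
  have "subspace (\<iota> ` c00_on k ?A)"
    unfolding subspace_def
  proof (intro conjI ballI allI)
    have "(\<lambda>w. 0) \<in> c00_on k ?A" by (simp add: c00_on_def c00_def)
    then show "0 \<in> \<iota> ` c00_on k ?A" using iota_zero by (metis image_eqI)
  next
    fix p q assume "p \<in> \<iota> ` c00_on k ?A" "q \<in> \<iota> ` c00_on k ?A"
    then obtain x y where xy: "x \<in> c00_on k ?A" "y \<in> c00_on k ?A" "p = \<iota> x" "q = \<iota> y" by blast
    have "(\<lambda>w. x w + y w) \<in> c00_on k ?A"
    proof (rule c00_onI)
      show "(\<lambda>w. x w + y w) \<in> c00 k" using xy by (intro c00_add c00_on_c00)
      fix w assume "x w + y w \<noteq> 0"
      then have "x w \<noteq> 0 \<or> y w \<noteq> 0" by auto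
      then show "w \<in> ?A" using c00_onD[OF xy(1)] c00_onD[OF xy(2)] by blast
    qed
    moreover have "p + q = \<iota> (\<lambda>w. x w + y w)" using xy by (simp add: c00_on_c00 iota_add)
    ultimately show "p + q \<in> \<iota> ` c00_on k ?A" by blast
  next
    fix c :: real and p assume "p \<in> \<iota> ` c00_on k ?A"
    then obtain x where x: "x \<in> c00_on k ?A" "p = \<iota> x" by blast
    then have "(\<lambda>w. c * x w) \<in> c00_on k ?A" by (auto simp: c00_on_def intro: c00_scale)
    moreover have "c *\<^sub>R p = \<iota> (\<lambda>w. c * x w)" using x by (simp add: c00_on_def iota_scale)
    ultimately show "c *\<^sub>R p \<in> \<iota> ` c00_on k ?A" by blast
  qed
  moreover have "basis_vec \<iota> ` ?A \<subseteq> \<iota> ` c00_on k ?A"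
    by (auto simp: basis_vec_def c00_on_def tree_nodes_def indicator_def intro!: image_eqI indicator_in_c00)
  ultimately have "span (basis_vec \<iota> ` ?A) \<subseteq> \<iota> ` c00_on k ?A" by (intro span_minimal)
  then show ?thesis unfolding tree_subspace_def by (rule closure_mono)
qed

lemma closure_c00_on_sequence:
  assumes "z \<in> closure (\<iota> ` c00_on k A)"
  shows "\<exists>u. (\<forall>n. u n \<in> c00_on k A) \<and> (\<lambda>n. \<iota> (u n)) \<longlonglongrightarrow> z"
proof -
  obtain f where f: "\<forall>n. f n \<in> \<iota> ` c00_on k A" "f \<longlonglongrightarrow> z"
    using assms unfolding closure_sequential by blast
  then have "\<forall>n. \<exists>x. x \<in> c00_on k A \<and> f n = \<iota> x" by blast
  then obtain u where u: "\<And>n. u n \<in> c00_on k A" "\<And>n. f n = \<iota> (u n)" by metis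
  have "f = (\<lambda>n. \<iota> (u n))" using u(2) by auto
  then show ?thesis using u(1) f(2) by auto
qed

text \<open>Lets the norm estimates apply to the multiples \<open>a i *\<^sub>R y i\<close> without
  recomputing supports.\<close>

lemma closure_c00_on_scale:
  assumes "z \<in> closure (\<iota> ` c00_on k A)"
  shows "c *\<^sub>R z \<in> closure (\<iota> ` c00_on k A)"
proof -
  obtain u where u: "\<forall>n. u n \<in> c00_on k A" "(\<lambda>n. \<iota> (u n)) \<longlonglongrightarrow> z"
    using closure_c00_on_sequence[OF assms] by (elim exE conjE)
  have "(\<lambda>w. c * u n w) \<in> c00_on k A" for n
    using u(1) by (auto simp: c00_on_def intro: c00_scale)
  moreover have "\<iota> (\<lambda>w. c * u n w) = c *\<^sub>R \<iota> (u n)" for n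
    using u(1) by (intro iota_scale) (auto simp: c00_on_def)
  ultimately have "\<forall>n. c *\<^sub>R \<iota> (u n) \<in> \<iota> ` c00_on k A"
    by (metis image_eqI)
  moreover have "(\<lambda>n. c *\<^sub>R \<iota> (u n)) \<longlonglongrightarrow> c *\<^sub>R z" by (intro tendsto_intros u(2))
  ultimately show ?thesis
    unfolding closure_sequential by (intro exI[of _ "\<lambda>n. c *\<^sub>R \<iota> (u n)"] conjI)
qed

lemma closure_c00_on_family:
  assumes I: "finite I" and y: "\<forall>i\<in>I. y i \<in> closure (\<iota> ` c00_on k (A i))"
  shows "\<exists>u. (\<forall>i\<in>I. \<forall>n. u i n \<in> c00_on k (A i)) \<and> (\<forall>i\<in>I. (\<lambda>n. \<iota> (u i n)) \<longlonglongrightarrow> y i) \<and>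
    (\<forall>n. (\<lambda>w. \<Sum>i\<in>I. u i n w) \<in> c00 k) \<and>
    (\<lambda>n. \<iota> (\<lambda>w. \<Sum>i\<in>I. u i n w)) \<longlonglongrightarrow> (\<Sum>i\<in>I. y i)"
proof -
  have "\<forall>i\<in>I. \<exists>u. (\<forall>n. u n \<in> c00_on k (A i)) \<and> (\<lambda>n. \<iota> (u n)) \<longlonglongrightarrow> y i"
    by (intro ballI closure_c00_on_sequence bspec[OF y])
  then obtain u where "\<forall>i\<in>I. (\<forall>n. u i n \<in> c00_on k (A i)) \<and> (\<lambda>n. \<iota> (u i n)) \<longlonglongrightarrow> y i"
    by (elim exE[OF bchoice])
  then have u: "\<forall>i\<in>I. \<forall>n. u i n \<in> c00_on k (A i)" "\<forall>i\<in>I. (\<lambda>n. \<iota> (u i n)) \<longlonglongrightarrow> y i"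
    by simp_all
  then have c: "u i n \<in> c00 k" if "i \<in> I" for i n using that c00_on_c00 by blast
  have U: "\<forall>n. (\<lambda>w. \<Sum>i\<in>I. u i n w) \<in> c00 k" using I c by (intro allI c00_sum)
  have "\<iota> (\<lambda>w. \<Sum>i\<in>I. u i n w) = (\<Sum>i\<in>I. \<iota> (u i n))" for n using I c by (rule iota_sum)
  moreover have "(\<lambda>n. \<Sum>i\<in>I. \<iota> (u i n)) \<longlonglongrightarrow> (\<Sum>i\<in>I. y i)" using u(2) by (intro tendsto_sum) simp
  ultimately have "(\<lambda>n. \<iota> (\<lambda>w. \<Sum>i\<in>I. u i n w)) \<longlonglongrightarrow> (\<Sum>i\<in>I. y i)" by simp
  with u U show ?thesis by (intro exI[of _ u] conjI)
qed

section \<open>Sums of vectors in distinct tree subspaces\<close>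

context
  fixes I :: "nat set" and s :: "nat \<Rightarrow> nat list" and l :: nat and v :: "nat list" and y :: "nat \<Rightarrow> 'b"
  assumes I: "finite I" "I \<noteq> {}" and s: "\<And>i. i \<in> I \<Longrightarrow> length (s i) = l" "inj_on s I"
begin

text \<open>Two initial segments of \<open>w\<close> of the same length coincide, and
  \<open>s\<close> is injective.\<close>

lemma tree_nodes_disjoint:
  assumes "i \<in> I" "j \<in> I" "w \<in> tree_nodes k (s i)" "w \<in> tree_nodes k (s j)"
  shows "i = j"
proof -
  have "s i = s j" using assms s(1) by (auto simp: tree_nodes_def prefix_def append_eq_append_conv)
  then show ?thesis using s(2) assms by (auto dest: inj_onD)
qed

lemma tree_component:
  assumes "\<And>i w. i \<in> I \<Longrightarrow> u i w \<noteq> (0::real) \<Longrightarrow> w \<in> tree_nodes k (s i)" and i: "i \<in> I"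
  shows "proj (tree_nodes k (s i)) (\<lambda>w. \<Sum>j\<in>I. u j w) = u i"
proof
  fix w
  show "proj (tree_nodes k (s i)) (\<lambda>w. \<Sum>j\<in>I. u j w) w = u i w"
  proof (cases "w \<in> tree_nodes k (s i)")
    case True
    have "u j w = 0" if "j \<in> I - {i}" for j
      using that assms(1)[of j w] tree_nodes_disjoint[OF i _ True, of j] by fastforce
    then have "(\<Sum>j\<in>I. u j w) = (\<Sum>j\<in>{i}. u j w)"
      using I(1) i by (intro sum.mono_neutral_right) simp_all
    then show ?thesis using True by (simp add: proj_def)
  next
    case False
    then show ?thesis using assms(1)[OF i] by (auto simp: proj_def)
  qed
qed

text \<open>The hypothesis concerns coordinates of the sum. Since the trees are disjoint, these are
  coordinates of the individual summands, so the cut-off at \<open>v\<close> can be made in each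
  summand separately.\<close>

lemma closure_after_if_before:
  assumes y: "\<And>i. i \<in> I \<Longrightarrow> y i \<in> tree_subspace k \<iota> (s i)"
    and v: "before k \<iota> v (\<Sum>i\<in>I. y i)" and i: "i \<in> I"
  shows "y i \<in> closure (\<iota> ` c00_on k {w \<in> tree_nodes k (s i). v \<prec>\<^sub>\<omega> w})"
proof -
  have cl: "\<forall>i\<in>I. y i \<in> closure (\<iota> ` c00_on k (tree_nodes k (s i)))"
    using y tree_subspace_closure by blast
  obtain u where u0: "\<forall>i\<in>I. \<forall>n. u i n \<in> c00_on k (tree_nodes k (s i))"
      "\<forall>i\<in>I. (\<lambda>n. \<iota> (u i n)) \<longlonglongrightarrow> y i"
      "\<forall>n. (\<lambda>w. \<Sum>i\<in>I. u i n w) \<in> c00 k"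
      "(\<lambda>n. \<iota> (\<lambda>w. \<Sum>i\<in>I. u i n w)) \<longlonglongrightarrow> (\<Sum>i\<in>I. y i)"
    using closure_c00_on_family[OF I(1) cl] by (elim exE conjE)
  have u: "u i n \<in> c00 k" "u i n w \<noteq> 0 \<Longrightarrow> w \<in> tree_nodes k (s i)"
      "(\<lambda>n. \<iota> (u i n)) \<longlonglongrightarrow> y i" if "i \<in> I" for i n w
    using that u0(1,2) by (auto simp only: c00_on_def)
  define U where "U n = (\<lambda>w. \<Sum>j\<in>I. u j n w)" for n
  have U: "U n \<in> c00 k" and Ulim: "(\<lambda>n. \<iota> (U n)) \<longlonglongrightarrow> (\<Sum>i\<in>I. y i)" for n
    using u0(3,4) by (simp_all add: U_def)
  define W where "W = {w \<in> seqs k. w \<preceq>\<^sub>\<omega> v}"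
  have W: "finite W" "W \<subseteq> seqs k" using finite_prec_seqs by (auto simp: W_def)
  \<comment> \<open>Approximants need not vanish up to \<open>v\<close>; their coordinates there
    merely tend to zero.\<close>
  have zero: "(\<lambda>n. u i n w) \<longlonglongrightarrow> 0" if w: "w \<in> W" for w
  proof (cases "w \<in> tree_nodes k (s i)")
    case True
    have "coords k \<iota> (\<Sum>i\<in>I. y i) w = 0"
      using v w unfolding before_def supp_def W_def by (auto simp: prec.not_less[symmetric])
    then have "(\<lambda>n. U n w) \<longlonglongrightarrow> 0" using tendsto_coords[OF U Ulim, of w] w W(2) by auto
    moreover have "U n w = u i n w" for n
      using fun_cong[OF tree_component[where u = "\<lambda>i. u i n", OF u(2) i], where x = w] True by (simp add: U_def proj_def)
    ultimately show ?thesis by simp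
  next
    case False
    then have "u i n w = 0" for n using u(2)[OF i] by blast
    then show ?thesis by simp
  qed
  define u' where "u' n = (\<lambda>w. u i n w - proj W (u i n) w)" for n
  \<comment> \<open>As \<open>W\<close> is finite, coordinatewise convergence suffices for the
    removed part to tend to zero in norm.\<close>
  have "(\<lambda>n. \<iota> (u i n) - (\<Sum>w\<in>W. u i n w *\<^sub>R basis_vec \<iota> w)) \<longlonglongrightarrow> y i - (\<Sum>w\<in>W. 0 *\<^sub>R basis_vec \<iota> w)"
    by (intro tendsto_intros u(3)[OF i] zero)
  then have lim: "(\<lambda>n. \<iota> (u' n)) \<longlonglongrightarrow> y i"
    unfolding u'_def using iota_diff[OF u(1)[OF i] c00_proj[OF u(1)[OF i]]] iota_proj_finite[OF W] by simp
  have "u' n \<in> c00_on k {w \<in> tree_nodes k (s i). v \<prec>\<^sub>\<omega> w}" for n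
  proof -
    have "u' n \<in> c00 k" unfolding u'_def by (intro c00_diff c00_proj u(1) i)
    moreover have "w \<in> tree_nodes k (s i) \<and> v \<prec>\<^sub>\<omega> w" if "u' n w \<noteq> 0" for w
    proof -
      have "w \<notin> W" "u i n w \<noteq> 0" using that by (auto simp: u'_def proj_def split: if_splits)
      moreover from this have "w \<in> tree_nodes k (s i)" using u(2)[OF i] by blast
      ultimately show ?thesis by (auto simp: W_def tree_nodes_def prec.not_le)
    qed
    ultimately show ?thesis by (auto simp: c00_on_def)
  qed
  then have "\<forall>n. \<iota> (u' n) \<in> \<iota> ` c00_on k {w \<in> tree_nodes k (s i). v \<prec>\<^sub>\<omega> w}" by blast
  then show ?thesis
    unfolding closure_sequential using lim by (intro exI[of _ "\<lambda>n. \<iota> (u' n)"] conjI)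
qed

text \<open>The support condition is stated through closures instead of \<open>before\<close>,
  because in this form it is stable under scaling each \<open>y i\<close>. Both bounds pass to the
  limit from approximants whose tree components are the \<open>u i n\<close>.\<close>

lemma norm_tree_sum:
  assumes d\<theta>: "real d * \<theta> > 1" and v: "\<And>i. i \<in> I \<Longrightarrow> s i \<prec>\<^sub>\<omega> v"
    and y: "\<And>i. i \<in> I \<Longrightarrow> y i \<in> closure (\<iota> ` c00_on k {w \<in> tree_nodes k (s i). v \<prec>\<^sub>\<omega> w})"
  shows "i \<in> I \<Longrightarrow> norm (y i) \<le> norm (\<Sum>i\<in>I. y i)"
    and "(\<And>i. i \<in> I \<Longrightarrow> norm (y i) \<le> M) \<Longrightarrow> norm (\<Sum>i\<in>I. y i) \<le> \<theta> * (real d - 1) / (1 - \<theta>) * M"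
proof -
  have cl: "\<forall>i\<in>I. y i \<in> closure (\<iota> ` c00_on k {w \<in> tree_nodes k (s i). v \<prec>\<^sub>\<omega> w})"
    using y by blast
  obtain u where u0: "\<forall>i\<in>I. \<forall>n. u i n \<in> c00_on k ({w \<in> tree_nodes k (s i). v \<prec>\<^sub>\<omega> w})"
      "\<forall>i\<in>I. (\<lambda>n. \<iota> (u i n)) \<longlonglongrightarrow> y i"
      "\<forall>n. (\<lambda>w. \<Sum>i\<in>I. u i n w) \<in> c00 k"
      "(\<lambda>n. \<iota> (\<lambda>w. \<Sum>i\<in>I. u i n w)) \<longlonglongrightarrow> (\<Sum>i\<in>I. y i)"
    using closure_c00_on_family[OF I(1) cl] by (elim exE conjE)
  have u: "u i n \<in> c00 k" "u i n w \<noteq> 0 \<Longrightarrow> w \<in> {w \<in> tree_nodes k (s i). v \<prec>\<^sub>\<omega> w}"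
      "(\<lambda>n. \<iota> (u i n)) \<longlonglongrightarrow> y i" if "i \<in> I" for i n w
    using that u0(1,2) by (auto simp only: c00_on_def)
  define U where "U n = (\<lambda>w. \<Sum>j\<in>I. u j n w)" for n
  have U: "U n \<in> c00 k" and Ulim: "(\<lambda>n. \<iota> (U n)) \<longlonglongrightarrow> (\<Sum>i\<in>I. y i)" for n
    using u0(3,4) by (simp_all add: U_def)
  have comp: "proj (tree_nodes k (s i)) (U n) = u i n" if "i \<in> I" for i n
    unfolding U_def using u(2) by (intro tree_component that) blast
  show "norm (y i) \<le> norm (\<Sum>i\<in>I. y i)" if i: "i \<in> I"
  proof (rule LIMSEQ_le)
    show "(\<lambda>n. norm (\<iota> (u i n))) \<longlonglongrightarrow> norm (y i)" by (intro tendsto_intros u(3) i)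
    show "(\<lambda>n. norm (\<iota> (U n))) \<longlonglongrightarrow> norm (\<Sum>i\<in>I. y i)" by (intro tendsto_norm Ulim)
    show "\<exists>K. \<forall>n\<ge>K. norm (\<iota> (u i n)) \<le> norm (\<iota> (U n))"
      using norm_iota_proj_le[OF U, of "tree_nodes k (s i)"] comp[OF i] by simp
  qed
  show "norm (\<Sum>i\<in>I. y i) \<le> \<theta> * (real d - 1) / (1 - \<theta>) * M" if M: "\<And>i. i \<in> I \<Longrightarrow> norm (y i) \<le> M"
  proof (rule LIMSEQ_le)
    \<comment> \<open>Approximants satisfy the bound \<open>M\<close> only up to an error; adding
      all the errors gives one bound for every \<open>i\<close>, and it tends to
      \<open>M\<close>.\<close>
    define M' where "M' n = M + (\<Sum>i\<in>I. norm (\<iota> (u i n) - y i))" for n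
    have "M' \<longlonglongrightarrow> M + (\<Sum>i\<in>I. norm (y i - y i))"
      unfolding M'_def by (intro tendsto_intros u(3))
    then show "(\<lambda>n. \<theta> * (real d - 1) / (1 - \<theta>) * M' n) \<longlonglongrightarrow> \<theta> * (real d - 1) / (1 - \<theta>) * M"
      by (intro tendsto_intros) simp
    show "(\<lambda>n. norm (\<iota> (U n))) \<longlonglongrightarrow> norm (\<Sum>i\<in>I. y i)" by (intro tendsto_norm Ulim)
    have le: "norm (\<iota> (u i n)) \<le> M' n" if "i \<in> I" for i n
    proof -
      have "norm (\<iota> (u i n)) \<le> norm (y i) + norm (\<iota> (u i n) - y i)" by (rule norm_triangle_sub)
      also have "norm (\<iota> (u i n) - y i) \<le> (\<Sum>i\<in>I. norm (\<iota> (u i n) - y i))"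
        using that I by (intro member_le_sum) auto
      finally show ?thesis using M[OF that] by (simp add: M'_def)
    qed
    have "norm (\<iota> (U n)) \<le> \<theta> * (real d - 1) / (1 - \<theta>) * M' n" for n
      unfolding norm_iota[OF U]
    proof (rule T_norm_trees_le[OF d \<theta> d\<theta>, of "s ` I" l v])
      show "s ` I \<noteq> {}" "\<And>r. r \<in> s ` I \<Longrightarrow> length r = l" "\<And>r. r \<in> s ` I \<Longrightarrow> r \<prec>\<^sub>\<omega> v"
        using I s v by auto
      show "finite {w. U n w \<noteq> 0}" by (rule finite_support_c00[OF U])
      show "v \<prec>\<^sub>\<omega> w \<and> (\<exists>r\<in>s ` I. w \<in> tree_nodes k r)" if nz: "U n w \<noteq> 0" for w
      proof -
        obtain i where "i \<in> I" "u i n w \<noteq> 0"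
          by (rule sum.not_neutral_contains_not_neutral[OF nz[unfolded U_def]])
        then show ?thesis using u(2)[of i n w] by auto
      qed
      show "T_norm k d \<theta> (proj (tree_nodes k r) (U n)) \<le> M' n" if "r \<in> s ` I" for r
        using that comp le norm_iota[OF u(1)] by auto
    qed
    then show "\<exists>K. \<forall>n\<ge>K. norm (\<iota> (U n)) \<le> \<theta> * (real d - 1) / (1 - \<theta>) * M' n" by blast
  qed
qed

end

end

section \<open>The canonical isomorphism with the finite-dimensional sup-norm space\<close>

text \<open>The lower estimate has constant \<open>1\<close>, so it gives both injectivity and an
  inverse of norm at most \<open>1\<close>; the isomorphism constant is then the upper constant
  alone.\<close>

lemma canonically_linfI:
  fixes y :: "nat \<Rightarrow> 'b::real_normed_vector"
  assumes N: "N \<ge> 1" and C: "0 < C"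
    and upper: "\<And>a. norm (\<Sum>i=1..N. a i *\<^sub>R y i) \<le> C * linf_norm N a"
    and lower: "\<And>a. linf_norm N a \<le> norm (\<Sum>i=1..N. a i *\<^sub>R y i)"
  shows "canonically_linf N y C"
proof -
  define \<Phi> where "\<Phi> a = (\<Sum>i=1..N. a i *\<^sub>R y i)" for a
  have add: "\<Phi> (\<lambda>i. a i + b i) = \<Phi> a + \<Phi> b" for a b
    by (simp add: \<Phi>_def scaleR_left_distrib sum.distrib)
  have scale: "\<Phi> (\<lambda>i. c * a i) = c *\<^sub>R \<Phi> a" for c a
    by (simp add: \<Phi>_def scaleR_sum_right)
  have unit: "\<Phi> (indicator {i}) = y i" if "i \<in> {1..N}" for i
  proof -
    have "\<Phi> (indicator {i}) = (\<Sum>j\<in>{i}. y j)"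
      unfolding \<Phi>_def using that by (intro sum.mono_neutral_cong_right) (auto simp: indicator_def)
    then show ?thesis by simp
  qed
  have inj: "inj_on \<Phi> (linf N)"
  proof (rule inj_onI)
    fix a b assume ab: "a \<in> linf N" "b \<in> linf N" "\<Phi> a = \<Phi> b"
    \<comment> \<open>The difference is written as a sum with a multiple so that \<open>add\<close>
      and \<open>scale\<close> rewrite it.\<close>
    have "\<Phi> (\<lambda>i. a i + (-1) * b i) = 0" using ab(3) by (simp only: add scale) simp
    then have "linf_norm N (\<lambda>i. a i + (-1) * b i) \<le> 0" using lower by (metis \<Phi>_def norm_zero)
    then have "a i = b i" if "i \<in> {1..N}" for i
      using that N by (auto simp: linf_norm_def)
    moreover have "a i = b i" if "i \<notin> {1..N}" for i using ab(1,2) that by (simp add: linf_def)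
    ultimately show "a = b" by blast
  qed
  have "\<Phi> ` linf N = span (y ` {1..N})"
  proof
    show "\<Phi> ` linf N \<subseteq> span (y ` {1..N})"
      unfolding \<Phi>_def by (intro image_subsetI span_sum span_scale span_base imageI)
    have "subspace (\<Phi> ` linf N)"
      unfolding subspace_def
    proof (intro conjI ballI allI)
      have "\<Phi> (\<lambda>i. 0) = 0" "(\<lambda>i. 0) \<in> linf N" by (auto simp: \<Phi>_def linf_def)
      then show "0 \<in> \<Phi> ` linf N" by (metis image_eqI)
    next
      fix p q assume "p \<in> \<Phi> ` linf N" "q \<in> \<Phi> ` linf N"
      then obtain a b where "a \<in> linf N" "b \<in> linf N" "p = \<Phi> a" "q = \<Phi> b" by blast
      then show "p + q \<in> \<Phi> ` linf N"
        by (intro image_eqI[of _ _ "\<lambda>i. a i + b i"]) (auto simp: add linf_def)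
    next
      fix c p assume "p \<in> \<Phi> ` linf N"
      then obtain a where "a \<in> linf N" "p = \<Phi> a" by blast
      then show "c *\<^sub>R p \<in> \<Phi> ` linf N"
        by (intro image_eqI[of _ _ "\<lambda>i. c * a i"]) (auto simp: scale linf_def)
    qed
    moreover have "y ` {1..N} \<subseteq> \<Phi> ` linf N"
    proof
      fix z assume "z \<in> y ` {1..N}"
      then obtain i where "i \<in> {1..N}" "z = y i" by blast
      then show "z \<in> \<Phi> ` linf N"
        using unit by (intro image_eqI[of _ _ "indicator {i}"]) (auto simp: linf_def indicator_def)
    qed
    ultimately show "span (y ` {1..N}) \<subseteq> \<Phi> ` linf N" by (intro span_minimal)
  qed
  with inj have "bij_betw \<Phi> (linf N) (span (y ` {1..N}))" by (simp add: bij_betw_def)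
  moreover have "norm (\<Phi> a) \<le> C * linf_norm N a" "linf_norm N a \<le> 1 * norm (\<Phi> a)" for a
    using upper lower by (simp_all add: \<Phi>_def)
  moreover have "C * 1 \<le> C" by simp
  ultimately show ?thesis
    unfolding canonically_linf_def using add scale unit C zero_less_one by blast
qed

theorem theorem9p2:
  fixes k d :: nat and \<theta> :: real
    and \<iota> :: "(nat list \<Rightarrow> real) \<Rightarrow> 'b::real_normed_vector" and T :: "'b set"
  assumes "k \<ge> 2" and "d \<ge> 1" and "0 < \<theta>" and "\<theta> < 1" and "real d * \<theta> > 1"
    and "T_completion k d \<theta> \<iota> T"
  shows "\<exists>C. \<forall>(N::nat) (s :: nat \<Rightarrow> nat list) (v :: nat list) (x :: 'b) (y :: nat \<Rightarrow> 'b).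
    N \<ge> 1 \<and>
    (\<forall>i\<in>{1..N}. s i \<in> seqs_le k) \<and>
    (\<forall>i\<in>{1..N}. \<forall>j\<in>{1..N}. i < j \<longrightarrow> s i \<prec>\<^sub>\<omega> s j) \<and>
    (\<forall>i\<in>{1..N}. length (s i) = length (s 1)) \<and> length (s 1) < k \<and>
    v \<in> seqs k \<and> s N \<prec>\<^sub>\<omega> v \<and>
    (\<forall>i\<in>{1..N}. y i \<in> tree_subspace k \<iota> (s i)) \<and>
    x = (\<Sum>i=1..N. y i) \<and>
    before k \<iota> v x
    \<longrightarrow>
      Max ((\<lambda>i. norm (y i)) ` {1..N}) \<le> norm x \<and>
      norm x \<le> \<theta> * (real d - 1) / (1 - \<theta>) * Max ((\<lambda>i. norm (y i)) ` {1..N}) \<and>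
      ((\<forall>i\<in>{1..N}. norm (y i) = 1) \<longrightarrow> canonically_linf N y C)"
\<comment> \<open>The witness depends on \<open>d\<close> and \<theta> alone and is fixed before
  \<open>N\<close>, the nodes and the vectors, which gives the claimed uniformity.\<close>
proof (intro exI[of _ "\<theta> * (real d - 1) / (1 - \<theta>)"] allI impI)
  fix N :: nat and s :: "nat \<Rightarrow> nat list" and v :: "nat list" and x :: 'b and y :: "nat \<Rightarrow> 'b"
  let ?C = "\<theta> * (real d - 1) / (1 - \<theta>)" and ?I = "{1..N}"
  let ?A = "\<lambda>i. {w \<in> tree_nodes k (s i). v \<prec>\<^sub>\<omega> w}"
  assume H: "N \<ge> 1 \<and> (\<forall>i\<in>?I. s i \<in> seqs_le k) \<and> (\<forall>i\<in>?I. \<forall>j\<in>?I. i < j \<longrightarrow> s i \<prec>\<^sub>\<omega> s j) \<and>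
    (\<forall>i\<in>?I. length (s i) = length (s 1)) \<and> length (s 1) < k \<and> v \<in> seqs k \<and> s N \<prec>\<^sub>\<omega> v \<and>
    (\<forall>i\<in>?I. y i \<in> tree_subspace k \<iota> (s i)) \<and> x = (\<Sum>i=1..N. y i) \<and> before k \<iota> v x"
  from H have N: "N \<ge> 1" by (elim conjE)
  from H have "\<forall>i\<in>?I. \<forall>j\<in>?I. i < j \<longrightarrow> s i \<prec>\<^sub>\<omega> s j" by (elim conjE)
  then have incr: "s i \<prec>\<^sub>\<omega> s j" if "i \<in> ?I" "j \<in> ?I" "i < j" for i j using that by blast
  from H have "\<forall>i\<in>?I. length (s i) = length (s 1)" by (elim conjE)
  then have len: "length (s i) = length (s 1)" if "i \<in> ?I" for i using that by blast
  from H have v: "s N \<prec>\<^sub>\<omega> v" by (elim conjE)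
  from H have "\<forall>i\<in>?I. y i \<in> tree_subspace k \<iota> (s i)" by (elim conjE)
  then have y: "y i \<in> tree_subspace k \<iota> (s i)" if "i \<in> ?I" for i using that by blast
  from H have x: "x = (\<Sum>i=1..N. y i)" by (elim conjE)
  from H have "before k \<iota> v x" by (elim conjE)
  then have before: "before k \<iota> v (\<Sum>i=1..N. y i)" by (simp only: x)
  have I: "finite ?I" "?I \<noteq> {}" using N by auto
  have inj: "inj_on s ?I"
  proof (rule linorder_inj_onI)
    show "s i \<noteq> s j" if "i < j" "i \<in> ?I" "j \<in> ?I" for i j
      using incr[OF that(2,3,1)] prec_irrefl by metis
  qed auto
  \<comment> \<open>Only the last node is assumed to precede \<open>v\<close>; the others do so by
    transitivity.\<close>
  have sv: "s i \<prec>\<^sub>\<omega> v" if "i \<in> ?I" for i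
  proof (cases "i = N")
    case False
    then have "s i \<prec>\<^sub>\<omega> s N" using that N by (intro incr) auto
    then show ?thesis using v by (rule prec_trans)
  qed (use v in simp)
  have cut: "y i \<in> closure (\<iota> ` c00_on k (?A i))" if "i \<in> ?I" for i
    by (rule closure_after_if_before[where l = "length (s 1)", OF assms(2,3,4,6) I _ inj _ before that])
      (fact len, fact y)
  have norm_ge: "norm (z i) \<le> norm (\<Sum>i=1..N. z i)"
    if "\<And>i. i \<in> ?I \<Longrightarrow> z i \<in> closure (\<iota> ` c00_on k (?A i))" "i \<in> ?I" for z i
    by (rule norm_tree_sum(1)[where l = "length (s 1)", OF assms(2,3,4,6) I _ inj assms(5) _ _ that(2)])
      (fact len, fact sv, fact that(1))
  have norm_le: "norm (\<Sum>i=1..N. z i) \<le> ?C * M"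
    if "\<And>i. i \<in> ?I \<Longrightarrow> z i \<in> closure (\<iota> ` c00_on k (?A i))" "\<And>i. i \<in> ?I \<Longrightarrow> norm (z i) \<le> M" for z M
    by (rule norm_tree_sum(2)[where l = "length (s 1)" and s = s, OF assms(2,3,4,6) I _ inj assms(5)])
      (fact len, fact sv, fact that(1), fact that(2))
  have "canonically_linf N y ?C" if one: "\<forall>i\<in>?I. norm (y i) = 1"
  proof (rule canonically_linfI[OF N])
    show "0 < ?C" using one_le_constant[OF assms(2-5)] by linarith
    fix a :: "nat \<Rightarrow> real"
    have cut': "a i *\<^sub>R y i \<in> closure (\<iota> ` c00_on k (?A i))" if "i \<in> ?I" for i
      by (rule closure_c00_on_scale[OF assms(2,3,4,6) cut[OF that]])
    have abs_le: "\<bar>a i\<bar> \<le> linf_norm N a" if "i \<in> ?I" for i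
      unfolding linf_norm_def using that by (intro Max_ge) auto
    \<comment> \<open>As each \<open>y i\<close> has norm \<open>1\<close>, the sup norm of
      \<open>a\<close> bounds every \<open>norm (a i *\<^sub>R y i)\<close> and serves as
      \<open>M\<close>.\<close>
    show "norm (\<Sum>i=1..N. a i *\<^sub>R y i) \<le> ?C * linf_norm N a"
      using one abs_le by (intro norm_le cut') auto
    have "\<bar>a i\<bar> \<le> norm (\<Sum>i=1..N. a i *\<^sub>R y i)" if "i \<in> ?I" for i
      using norm_ge[of "\<lambda>i. a i *\<^sub>R y i", OF cut' that] one that by simp
    then show "linf_norm N a \<le> norm (\<Sum>i=1..N. a i *\<^sub>R y i)"
      unfolding linf_norm_def using N by simp
  qed
  moreover have "Max ((\<lambda>i. norm (y i)) ` ?I) \<le> norm x"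
    using norm_ge[of y] cut I unfolding x by simp
  moreover have "norm x \<le> ?C * Max ((\<lambda>i. norm (y i)) ` ?I)"
    unfolding x by (intro norm_le cut Max_ge) auto
  ultimately show "Max ((\<lambda>i. norm (y i)) ` ?I) \<le> norm x \<and>
      norm x \<le> ?C * Max ((\<lambda>i. norm (y i)) ` ?I) \<and>
      ((\<forall>i\<in>?I. norm (y i) = 1) \<longrightarrow> canonically_linf N y ?C)" by blast
qed

end
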